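(* There is an absolute constant $c\ge1$ such that the following holds. Let $k:(0,1]\to\mathbb R$ be a non-negative, continuous and strictly decreasing function with $\lim_{x\to0}k(x)=\infty$ and $k\in L_2[0,1]$. Then for the weakly singular integral operator $T_K:L_2[0,1]\to L_q[0,1]$, $1\le q<\infty$, given by $$(T_Kf)(t)=\int_0^1k(|t-x|)f(x)\,dx,$$ the inequality $$n^{1/2}d_n(T_K:L_2[0,1]\to L_q[0,1])\le c\sqrt q\left(\int_0^{1/n}(k(u))^2\,du\right)^{1/2},\quad n\in\mathbb N,$$ holds true.
   Context: For a bounded linear operator $T:X\to Y$ between Banach spaces, the $n$-th Kolmogorov number is $d_n(T)=\inf\{\|Q_F^YT\|:F\text{ subspace of }Y,\ \dim F<n\}$, where $Q_F^Y:Y\to Y/F$ is the quotient map. *)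

theory Defs
  imports "HOL-Analysis.Analysis"
begin

abbreviation unit_lborel :: "real measure" where
  "unit_lborel \<equiv> restrict_space lborel {0..1}"

definition ae_rel :: "(real \<Rightarrow> real) \<Rightarrow> (real \<Rightarrow> real) \<Rightarrow> bool" where
  "ae_rel f g \<longleftrightarrow> f \<in> borel_measurable unit_lborel \<and> g \<in> borel_measurable unit_lborel \<and>
     (AE x in unit_lborel. f x = g x)"

lemma part_equivp_ae_rel: "part_equivp ae_rel"
proof (rule part_equivpI)
  show "\<exists>f. ae_rel f f"
    by (rule exI[of _ "\<lambda>_. 0"]) (simp add: ae_rel_def)
  show "symp ae_rel"
    by (auto simp: symp_def ae_rel_def elim: AE_mp)
  show "transp ae_rel"
    by (auto simp: transp_def ae_rel_def elim: AE_mp)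
qed

text \<open>Classes of real measurable functions on \<open>[0,1]\<close> modulo equality almost everywhere; every
  \<open>L\<^sub>p[0,1]\<close> is a linear subspace of this space.\<close>

quotient_type ae_fun = "real \<Rightarrow> real" / partial: ae_rel
  by (rule part_equivp_ae_rel)

instantiation ae_fun :: real_vector
begin

lift_definition zero_ae_fun :: ae_fun is "\<lambda>_. 0"
  by (simp add: ae_rel_def)

lift_definition plus_ae_fun :: "ae_fun \<Rightarrow> ae_fun \<Rightarrow> ae_fun" is "\<lambda>f g x. f x + g x"
  by (auto simp: ae_rel_def)

lift_definition minus_ae_fun :: "ae_fun \<Rightarrow> ae_fun \<Rightarrow> ae_fun" is "\<lambda>f g x. f x - g x"
  by (auto simp: ae_rel_def)

lift_definition uminus_ae_fun :: "ae_fun \<Rightarrow> ae_fun" is "\<lambda>f x. - f x"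
  by (auto simp: ae_rel_def)

lift_definition scaleR_ae_fun :: "real \<Rightarrow> ae_fun \<Rightarrow> ae_fun" is "\<lambda>c f x. c * f x"
  by (auto simp: ae_rel_def)

instance
  by standard (transfer; auto simp: ae_rel_def algebra_simps)+

end

lift_definition in_Lp :: "real \<Rightarrow> ae_fun \<Rightarrow> bool" is
  "\<lambda>p f. integrable unit_lborel (\<lambda>x. \<bar>f x\<bar> powr p)"
  unfolding ae_rel_def by (intro integrable_cong_AE) (auto elim: AE_mp)

definition Lp :: "real \<Rightarrow> ae_fun set" where
  "Lp p = {f. in_Lp p f}"

lift_definition Lp_norm :: "real \<Rightarrow> ae_fun \<Rightarrow> real" is
  "\<lambda>p f. (LINT x|unit_lborel. \<bar>f x\<bar> powr p) powr (1 / p)"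
  unfolding ae_rel_def by (intro arg_cong2[where f = "(powr)"] integral_cong_AE) (auto elim: AE_mp)

text \<open>The operator is applied to a representative. For \<open>f \<in> L\<^sub>2\<close> and \<open>k\<close> as in the theorem the result
  does not depend on its choice (see \<open>weak_sing_op_abs\<close>). The value \<open>k 0\<close> is irrelevant, since it
  only enters the integral at the single point \<open>x = t\<close>.\<close>

definition weak_sing_op :: "(real \<Rightarrow> real) \<Rightarrow> ae_fun \<Rightarrow> ae_fun" where
  "weak_sing_op k f = abs_ae_fun (\<lambda>t. LINT x|unit_lborel. k \<bar>t - x\<bar> * rep_ae_fun f x)"

lemma rep_abs_ae_fun:
  assumes "f \<in> borel_measurable unit_lborel"
  shows "ae_rel (rep_ae_fun (abs_ae_fun f)) f"
  using assms Quotient3_rep_abs[OF Quotient3_ae_fun] by (simp add: ae_rel_def)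

lemma abs_ae_fun_cong:
  assumes "\<And>x. x \<in> {0..1} \<Longrightarrow> f x = g x"
  shows "abs_ae_fun f = abs_ae_fun g"
proof -
  have "f \<in> borel_measurable unit_lborel \<longleftrightarrow> g \<in> borel_measurable unit_lborel"
    by (rule measurable_cong) (use assms in \<open>simp add: space_restrict_space\<close>)
  moreover have "(AE x in unit_lborel. f x = h x) \<longleftrightarrow> (AE x in unit_lborel. g x = h x)" for h
    by (rule AE_cong) (use assms in \<open>simp add: space_restrict_space\<close>)
  ultimately have "ae_rel f = ae_rel g"
    by (simp add: ae_rel_def fun_eq_iff)
  moreover have "quot_type ae_rel Abs_ae_fun Rep_ae_fun"
    by (rule quot_type.intro)
      (use part_equivp_ae_rel Rep_ae_fun Rep_ae_fun_inverse Abs_ae_fun_inverse Rep_ae_fun_inject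
        in auto)
  ultimately show ?thesis
    by (simp add: abs_ae_fun_def quot_type.abs_def)
qed

lemma weak_sing_op_abs:
  assumes "f \<in> borel_measurable unit_lborel"
    and k: "\<And>t. t \<in> {0..1} \<Longrightarrow> (\<lambda>x. k \<bar>t - x\<bar>) \<in> borel_measurable unit_lborel"
  shows "weak_sing_op k (abs_ae_fun f) = abs_ae_fun (\<lambda>t. LINT x|unit_lborel. k \<bar>t - x\<bar> * f x)"
proof -
  have r: "ae_rel (rep_ae_fun (abs_ae_fun f)) f"
    by (rule rep_abs_ae_fun) fact
  have "(LINT x|unit_lborel. k \<bar>t - x\<bar> * rep_ae_fun (abs_ae_fun f) x) =
        (LINT x|unit_lborel. k \<bar>t - x\<bar> * f x)" if "t \<in> {0..1}" for t
    using r k[OF that] unfolding ae_rel_def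
    by (intro integral_cong_AE borel_measurable_times) (auto elim: AE_mp)
  then show ?thesis
    unfolding weak_sing_op_def by (rule abs_ae_fun_cong)
qed

text \<open>Below a normed space is given by a linear subspace of a real vector space (its carrier)
  together with a norm function on it, because \<open>L\<^sub>p[0,1]\<close> for variable \<open>p\<close> cannot be a family of
  types.\<close>

definition bounded_operator ::
    "'a::real_vector set \<Rightarrow> ('a \<Rightarrow> real) \<Rightarrow> 'b::real_vector set \<Rightarrow> ('b \<Rightarrow> real) \<Rightarrow> ('a \<Rightarrow> 'b) \<Rightarrow> bool" where
  "bounded_operator X NX Y NY T \<longleftrightarrow>
     (\<forall>x\<in>X. T x \<in> Y) \<and>
     (\<forall>x\<in>X. \<forall>y\<in>X. T (x + y) = T x + T y) \<and>
     (\<forall>a. \<forall>x\<in>X. T (a *\<^sub>R x) = a *\<^sub>R T x) \<and>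
     (\<exists>C. \<forall>x\<in>X. NY (T x) \<le> C * NX x)"

text \<open>The norm of the coset \<open>Q\<^sub>F y = y + F\<close> in the quotient space.\<close>

definition quotient_norm :: "('b::real_vector \<Rightarrow> real) \<Rightarrow> 'b set \<Rightarrow> 'b \<Rightarrow> real" where
  "quotient_norm NY F y = (INF z\<in>F. NY (y - z))"

definition operator_norm :: "'a set \<Rightarrow> ('a \<Rightarrow> real) \<Rightarrow> ('b \<Rightarrow> real) \<Rightarrow> ('a \<Rightarrow> 'b) \<Rightarrow> real" where
  "operator_norm X NX NY T = (SUP x\<in>{x\<in>X. NX x \<le> 1}. NY (T x))"

text \<open>Finite-dimensionality is required separately because \<^const>\<open>dim\<close> is \<open>0\<close> on
  infinite-dimensional spaces. The infima and suprema are over bounded nonempty sets, hence the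
  intended ones, whenever \<open>n \<ge> 1\<close> and \<^term>\<open>bounded_operator X NX Y NY T\<close>.\<close>

definition kolmogorov_number ::
    "'a::real_vector set \<Rightarrow> ('a \<Rightarrow> real) \<Rightarrow> 'b::real_vector set \<Rightarrow> ('b \<Rightarrow> real) \<Rightarrow> nat \<Rightarrow> ('a \<Rightarrow> 'b) \<Rightarrow> real" where
  "kolmogorov_number X NX Y NY n T =
     (INF F\<in>{F. subspace F \<and> F \<subseteq> Y \<and> (\<exists>B. finite B \<and> F \<subseteq> span B) \<and> dim F < n}.
        operator_norm X NX (quotient_norm NY F) T)"

end

theory Submission
  imports Defs
begin

text \<open>
  Write \<open>E a = \<integral>\<^sub>0\<^sup>a k\<^sup>2\<close> and let \<open>K\<^sub>t = k \<bar>t - \<cdot>\<bar>\<close> be the row of the kernel at \<open>t\<close>, so that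
  \<open>T f t\<close> is the inner product of \<open>K\<^sub>t\<close> with \<open>f\<close>. The proof combines two approximations of
  different nature, each using about \<open>n / 2\<close> dimensions.

  \<^bold>\<open>Regularity.\<close> As \<open>k \<ge> 0\<close>, the inequality \<open>(a - b)\<^sup>2 \<le> \<bar>a\<^sup>2 - b\<^sup>2\<bar>\<close> turns the \<open>L\<^sub>2\<close> distance of two
  rows into the \<open>L\<^sub>1\<close> distance of two translates of \<open>k \<bar>\<cdot>\<bar>\<^sup>2\<close>, which telescopes because this function is unimodal:
  \<open>\<parallel>K\<^sub>t - K\<^sub>s\<parallel>\<^sup>2 \<le> 4 E \<bar>t - s\<bar>\<close> (lemma \<open>row_diff_norm\<close>). Freezing \<open>t\<close> on a grid with mesh \<open>1 / p\<close>
  therefore gives an operator of rank \<open>p\<close>, and the remainder has rows of norm at most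
  \<open>\<rho> = 2 (E (1 / p))\<^sup>1\<^sup>/\<^sup>2\<close>.

  \<^bold>\<open>Randomness.\<close> This alone bounds the widths by \<open>\<rho>\<close>; the additional factor \<open>p\<^sup>-\<^sup>1\<^sup>/\<^sup>2\<close> needs a random
  subspace. Freezing \<open>t\<close> on a second, very fine grid with \<open>N\<close> points reduces the remainder to finitely
  many rows \<open>w\<^sub>1, \<dots>, w\<^sub>N\<close>. The lemma \<open>finite_kolmogorov_width\<close> shows that the image of the unit ball in
  \<open>\<real>\<^sup>N\<close>, with the normalised \<open>\<ell>\<^sub>q\<close> norm, is within \<open>C (q / p)\<^sup>1\<^sup>/\<^sup>2 \<rho>\<close> of some \<open>p\<close>-dimensional subspace.
  This is the bound \<open>p\<^sup>1\<^sup>/\<^sup>2 d\<^sub>p(u) \<le> C \<ell>(u)\<close> of Pajor and Tomczak-Jaegermann, where \<open>\<ell>(u)\<close> is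
  controlled by Khintchine's inequality with constant of order \<open>q\<^sup>1\<^sup>/\<^sup>2\<close>. The subspace is spanned
  by images of \<open>p\<close> random sign vectors \<open>\<epsilon>\<close>. A functional \<open>\<phi>\<close> that annihilates it satisfies
  \<open>\<Sum> \<bar>\<langle>u\<^sup>* \<phi>, \<epsilon>\<^sub>j\<rangle>\<bar> = 0\<close>, whereas the mean of this sum is at least \<open>p \<parallel>u\<^sup>* \<phi>\<parallel> / 2\<close>. So \<open>\<parallel>u\<^sup>* \<phi>\<parallel>\<close> is bounded by
  the largest deviation of the sum from its mean over the dual ball. Symmetrization and contraction bound the
  expected deviation by that of the linear process, that is, by \<open>p\<^sup>1\<^sup>/\<^sup>2 \<ell>(u)\<close>
  (lemma \<open>low_Mstar_estimate\<close>).

  The duality between functionals that annihilate a subspace and distances to it is explicit. It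
  suffices to treat an even integer \<open>2 m \<ge> q\<close>, for which a near-minimiser \<open>r\<close> of the distance has the
  almost annihilating functional \<open>r\<^sup>2\<^sup>m\<^sup>-\<^sup>1\<close> (lemma \<open>almost_dual_functional\<close>).
\<close>

section \<open>Rademacher averages and random sections of a convex body\<close>

definition avg :: "'a set \<Rightarrow> ('a \<Rightarrow> real) \<Rightarrow> real" where
  "avg \<Omega> f = (\<Sum>\<omega>\<in>\<Omega>. f \<omega>) / real (card \<Omega>)"

lemma avg_mono: "(\<And>\<omega>. \<omega> \<in> \<Omega> \<Longrightarrow> f \<omega> \<le> g \<omega>) \<Longrightarrow> avg \<Omega> f \<le> avg \<Omega> g"
  unfolding avg_def by (intro divide_right_mono sum_mono) auto

lemma avg_cong: "(\<And>\<omega>. \<omega> \<in> \<Omega> \<Longrightarrow> f \<omega> = g \<omega>) \<Longrightarrow> avg \<Omega> f = avg \<Omega> g"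
  by (simp add: avg_def)

lemma avg_add: "avg \<Omega> (\<lambda>\<omega>. f \<omega> + g \<omega>) = avg \<Omega> f + avg \<Omega> g"
  by (simp add: avg_def sum.distrib add_divide_distrib)

lemma avg_cmult: "avg \<Omega> (\<lambda>\<omega>. c * f \<omega>) = c * avg \<Omega> f"
  by (simp add: avg_def sum_distrib_left)

lemma avg_multc: "avg \<Omega> (\<lambda>\<omega>. f \<omega> * c) = avg \<Omega> f * c"
  by (simp add: avg_def sum_distrib_right)

lemma avg_nonneg: "(\<And>\<omega>. \<omega> \<in> \<Omega> \<Longrightarrow> 0 \<le> f \<omega>) \<Longrightarrow> 0 \<le> avg \<Omega> f"
  unfolding avg_def by (intro divide_nonneg_nonneg sum_nonneg) auto

lemma avg_const: "finite \<Omega> \<Longrightarrow> \<Omega> \<noteq> {} \<Longrightarrow> avg \<Omega> (\<lambda>_. c) = c"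
  by (simp add: avg_def)

lemma avg_swap: "avg A (\<lambda>x. avg B (f x)) = avg B (\<lambda>y. avg A (\<lambda>x. f x y))"
  unfolding avg_def sum_divide_distrib by (subst sum.swap) (simp add: mult.commute)

lemma avg_sum: "avg \<Omega> (\<lambda>\<omega>. \<Sum>i\<in>I. f i \<omega>) = (\<Sum>i\<in>I. avg \<Omega> (f i))"
  unfolding avg_def by (subst sum.swap) (simp add: sum_divide_distrib)

lemma avg_attained:
  assumes "finite \<Omega>" "\<Omega> \<noteq> {}"
  obtains \<omega> where "\<omega> \<in> \<Omega>" "f \<omega> \<le> avg \<Omega> f"
proof -
  have "\<not> (\<forall>\<omega>\<in>\<Omega>. avg \<Omega> f < f \<omega>)"
  proof
    assume "\<forall>\<omega>\<in>\<Omega>. avg \<Omega> f < f \<omega>"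
    then have "(\<Sum>\<omega>\<in>\<Omega>. avg \<Omega> f) < (\<Sum>\<omega>\<in>\<Omega>. f \<omega>)"
      using assms by (intro sum_strict_mono) auto
    then show False using assms by (simp add: avg_def)
  qed
  then show ?thesis using that by force
qed

text \<open>The expectation over \<open>n\<close> independent uniform elements of \<open>\<Omega>\<close>. Drawing them one at a time as a list
makes every statement about independence an induction on \<open>n\<close>.\<close>

fun iavg :: "'a set \<Rightarrow> nat \<Rightarrow> ('a list \<Rightarrow> real) \<Rightarrow> real" where
  "iavg \<Omega> 0 F = F []"
| "iavg \<Omega> (Suc n) F = avg \<Omega> (\<lambda>\<omega>. iavg \<Omega> n (\<lambda>ws. F (\<omega> # ws)))"

lemma iavg_mono:
  "(\<And>ws. set ws \<subseteq> \<Omega> \<Longrightarrow> length ws = n \<Longrightarrow> F ws \<le> G ws) \<Longrightarrow> iavg \<Omega> n F \<le> iavg \<Omega> n G"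
  by (induction n arbitrary: F G) (auto intro!: avg_mono)

lemma iavg_add: "iavg \<Omega> n (\<lambda>ws. F ws + G ws) = iavg \<Omega> n F + iavg \<Omega> n G"
  by (induction n arbitrary: F G) (auto simp: avg_add)

lemma iavg_cmult: "iavg \<Omega> n (\<lambda>ws. c * F ws) = c * iavg \<Omega> n F"
  by (induction n arbitrary: F) (auto simp: avg_cmult)

lemma iavg_const: "finite \<Omega> \<Longrightarrow> \<Omega> \<noteq> {} \<Longrightarrow> iavg \<Omega> n (\<lambda>_. c) = c"
  by (induction n) (auto simp: avg_const)

lemma iavg_sum: "iavg \<Omega> n (\<lambda>ws. \<Sum>i\<in>I. F i ws) = (\<Sum>i\<in>I. iavg \<Omega> n (F i))"
  by (induction n arbitrary: F) (auto simp: avg_sum)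

lemma iavg_avg_swap: "avg \<Omega> (\<lambda>\<omega>. iavg \<Omega> n (F \<omega>)) = iavg \<Omega> n (\<lambda>ws. avg \<Omega> (\<lambda>\<omega>. F \<omega> ws))"
proof (induction n arbitrary: F)
  case (Suc n)
  show ?case
    unfolding iavg.simps Suc.IH[symmetric] by (rule avg_swap)
qed simp

lemma iavg_exp_sum:
  "iavg \<Omega> n (\<lambda>ws. exp (\<Sum>\<omega>\<leftarrow>ws. g \<omega>)) = avg \<Omega> (\<lambda>\<omega>. exp (g \<omega>)) ^ n"
proof (induction n)
  case (Suc n)
  then show ?case by (simp add: exp_add iavg_cmult avg_multc)
qed simp

lemma iavg_attained:
  assumes "finite \<Omega>" "\<Omega> \<noteq> {}"
  shows "\<exists>ws. set ws \<subseteq> \<Omega> \<and> length ws = n \<and> F ws \<le> iavg \<Omega> n F"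
proof (induction n arbitrary: F)
  case (Suc n)
  obtain \<omega> where \<omega>: "\<omega> \<in> \<Omega>"
    "iavg \<Omega> n (\<lambda>ws. F (\<omega> # ws)) \<le> avg \<Omega> (\<lambda>\<omega>. iavg \<Omega> n (\<lambda>ws. F (\<omega> # ws)))"
    by (rule avg_attained[OF assms, where f = "\<lambda>\<omega>. iavg \<Omega> n (\<lambda>ws. F (\<omega> # ws))"])
  obtain ws where "set ws \<subseteq> \<Omega>" "length ws = n" "F (\<omega> # ws) \<le> iavg \<Omega> n (\<lambda>ws. F (\<omega> # ws))"
    using Suc.IH[of "\<lambda>ws. F (\<omega> # ws)"] by auto
  with \<omega> show ?case by (intro exI[of _ "\<omega> # ws"]) auto
qed auto

text \<open>A sign vector is encoded by the set of its positive coordinates, so the uniform distribution on sign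
vectors indexed by \<open>A\<close> is the average over \<open>Pow A\<close>.\<close>

definition rad :: "nat set \<Rightarrow> nat \<Rightarrow> real" where
  "rad \<omega> l = (if l \<in> \<omega> then 1 else -1)"

lemma avg_Pow_insert:
  assumes "finite A" "x \<notin> A"
  shows "avg (Pow (insert x A)) f = avg (Pow A) (\<lambda>S. (f S + f (insert x S)) / 2)"
proof -
  have "(\<Sum>S\<in>Pow (insert x A). f S) = (\<Sum>S\<in>Pow A. f S) + (\<Sum>S\<in>insert x ` Pow A. f S)"
    unfolding Pow_insert using assms by (intro sum.union_disjoint) auto
  also have "(\<Sum>S\<in>insert x ` Pow A. f S) = (\<Sum>S\<in>Pow A. f (insert x S))"
    using assms by (subst sum.reindex) (auto simp: inj_on_def)
  finally show ?thesis
    using assms by (simp add: avg_def card_Pow sum.distrib sum_divide_distrib[symmetric])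
qed

lemma rad_sum_insert:
  assumes "finite A" "x \<notin> A" "S \<subseteq> A"
  shows "(\<Sum>l\<in>insert x A. c l * rad S l) = (\<Sum>l\<in>A. c l * rad S l) - c x"
    and "(\<Sum>l\<in>insert x A. c l * rad (insert x S) l) = (\<Sum>l\<in>A. c l * rad S l) + c x"
proof -
  have "(\<Sum>l\<in>A. c l * rad (insert x S) l) = (\<Sum>l\<in>A. c l * rad S l)"
    using assms by (intro sum.cong) (auto simp: rad_def)
  moreover have "x \<notin> S" using assms by auto
  ultimately show "(\<Sum>l\<in>insert x A. c l * rad S l) = (\<Sum>l\<in>A. c l * rad S l) - c x"
    and "(\<Sum>l\<in>insert x A. c l * rad (insert x S) l) = (\<Sum>l\<in>A. c l * rad S l) + c x"
    using assms by (auto simp: rad_def)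
qed

lemma rad_sum_compl:
  assumes "S \<subseteq> A"
  shows "(\<Sum>l\<in>A. c l * rad (A - S) l) = - (\<Sum>l\<in>A. c l * rad S l)"
  unfolding sum_negf[symmetric] by (intro sum.cong) (auto simp: rad_def)

text \<open>Compare the power series termwise, using \<open>2\<^sup>n n! \<le> (2 n)!\<close>.\<close>

lemma cosh_le_exp_half_square: "(exp x + exp (- x)) / 2 \<le> exp (x\<^sup>2 / 2)" for x :: real
proof -
  define f where "f n = x ^ (2 * n) / fact (2 * n)" for n
  have "f sums cosh x"
  proof -
    have "(\<lambda>n. if even (2 * n) then x ^ (2 * n) /\<^sub>R fact (2 * n) else 0) sums cosh x"
      by (subst sums_mono_reindex[where g = "\<lambda>n. 2 * n" and f = "\<lambda>n. if even n then x ^ n /\<^sub>R fact n else 0"])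
        (use cosh_converges[of x] in \<open>auto simp: strict_mono_def image_iff dvd_def\<close>)
    then show ?thesis by (simp add: f_def[abs_def] divide_inverse mult.commute)
  qed
  moreover have "(\<lambda>n. y ^ n / fact n) sums exp y" for y :: real
    using exp_converges[of y] by (simp add: divide_inverse mult.commute)
  moreover have "f n \<le> (x\<^sup>2 / 2) ^ n / fact n" for n
  proof -
    have "2 ^ n * fact n \<le> (fact (2 * n) :: real)"
    proof (induction n)
      case (Suc n)
      have "2 ^ Suc n * fact (Suc n) = (2 * real n + 2) * (2 ^ n * fact n)" by simp
      also have "\<dots> \<le> (2 * real n + 2) * (1 * fact (2 * n))" using Suc by simp
      also have "\<dots> \<le> (2 * real n + 2) * ((2 * real n + 1) * fact (2 * n))"
        by (intro mult_left_mono mult_right_mono) auto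
      finally show ?case by (simp add: algebra_simps)
    qed simp
    then have "x ^ (2 * n) / fact (2 * n) \<le> x ^ (2 * n) / (2 ^ n * fact n)"
      by (intro divide_left_mono) auto
    then show ?thesis by (simp add: f_def power_divide power_mult)
  qed
  ultimately have "cosh x \<le> exp (x\<^sup>2 / 2)" by (meson sums_le)
  then show ?thesis unfolding cosh_field_def .
qed

lemma rad_mgf:
  assumes "finite A"
  shows "avg (Pow A) (\<lambda>S. exp (\<Sum>l\<in>A. c l * rad S l)) \<le> exp ((\<Sum>l\<in>A. (c l)\<^sup>2) / 2)"
  using assms
proof (induction A)
  case (insert x A)
  have "avg (Pow (insert x A)) (\<lambda>S. exp (\<Sum>l\<in>insert x A. c l * rad S l))
      = avg (Pow A) (\<lambda>S. (exp (c x) + exp (- c x)) / 2 * exp (\<Sum>l\<in>A. c l * rad S l))"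
    unfolding avg_Pow_insert[OF insert(1,2)]
  proof (rule avg_cong)
    fix S assume "S \<in> Pow A"
    then have S: "S \<subseteq> A" by simp
    show "(exp (\<Sum>l\<in>insert x A. c l * rad S l) + exp (\<Sum>l\<in>insert x A. c l * rad (insert x S) l)) / 2
       = (exp (c x) + exp (- c x)) / 2 * exp (\<Sum>l\<in>A. c l * rad S l)"
      unfolding rad_sum_insert[OF insert(1,2) S] by (simp add: exp_add exp_diff exp_minus field_simps)
  qed
  also have "\<dots> \<le> exp ((c x)\<^sup>2 / 2) * exp ((\<Sum>l\<in>A. (c l)\<^sup>2) / 2)"
    unfolding avg_cmult using insert(3)
    by (intro mult_mono cosh_le_exp_half_square) (auto intro!: avg_nonneg)
  also have "\<dots> = exp ((\<Sum>l\<in>insert x A. (c l)\<^sup>2) / 2)"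
    using insert by (simp add: exp_add[symmetric] add_divide_distrib)
  finally show ?case .
qed (simp add: avg_def)

lemma rad_second_moment:
  assumes "finite A"
  shows "avg (Pow A) (\<lambda>S. (\<Sum>l\<in>A. c l * rad S l)\<^sup>2) = (\<Sum>l\<in>A. (c l)\<^sup>2)"
  using assms
proof (induction A)
  case (insert x A)
  have alg: "((a - b)\<^sup>2 + (a + b)\<^sup>2) / 2 = a\<^sup>2 + b\<^sup>2" for a b :: real
    by (simp add: power2_eq_square algebra_simps)
  have "avg (Pow (insert x A)) (\<lambda>S. (\<Sum>l\<in>insert x A. c l * rad S l)\<^sup>2)
      = avg (Pow A) (\<lambda>S. (\<Sum>l\<in>A. c l * rad S l)\<^sup>2 + (c x)\<^sup>2)"
    unfolding avg_Pow_insert[OF insert(1,2)]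
    by (rule avg_cong) (simp add: rad_sum_insert[OF insert(1,2)] alg del: sum.insert)
  also have "\<dots> = (\<Sum>l\<in>insert x A. (c l)\<^sup>2)"
    using insert by (simp add: avg_add avg_const Pow_not_empty)
  finally show ?case .
qed (simp add: avg_def)

lemma rad_fourth_moment:
  assumes "finite A"
  shows "avg (Pow A) (\<lambda>S. (\<Sum>l\<in>A. c l * rad S l) ^ 4) \<le> 3 * (\<Sum>l\<in>A. (c l)\<^sup>2)\<^sup>2"
  using assms
proof (induction A)
  case (insert x A)
  have alg: "((a - b) ^ 4 + (a + b) ^ 4) / 2 = a ^ 4 + 6 * b\<^sup>2 * a\<^sup>2 + b ^ 4" for a b :: real
    by (simp add: power4_eq_xxxx power2_eq_square algebra_simps)
  have sq: "3 * a\<^sup>2 + 6 * b\<^sup>2 * a + 3 * b ^ 4 = 3 * (b\<^sup>2 + a)\<^sup>2" for a b :: real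
    by (simp add: power4_eq_xxxx power2_eq_square algebra_simps)
  have "avg (Pow (insert x A)) (\<lambda>S. (\<Sum>l\<in>insert x A. c l * rad S l) ^ 4)
      = avg (Pow A) (\<lambda>S. (\<Sum>l\<in>A. c l * rad S l) ^ 4 + 6 * (c x)\<^sup>2 * (\<Sum>l\<in>A. c l * rad S l)\<^sup>2 + (c x) ^ 4)"
    unfolding avg_Pow_insert[OF insert(1,2)]
    by (rule avg_cong) (simp add: rad_sum_insert[OF insert(1,2)] alg del: sum.insert)
  also have "\<dots> = avg (Pow A) (\<lambda>S. (\<Sum>l\<in>A. c l * rad S l) ^ 4)
       + 6 * (c x)\<^sup>2 * (\<Sum>l\<in>A. (c l)\<^sup>2) + (c x) ^ 4"
    using insert(1) by (simp add: avg_add avg_cmult avg_const rad_second_moment Pow_not_empty)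
  also have "\<dots> \<le> 3 * (\<Sum>l\<in>A. (c l)\<^sup>2)\<^sup>2 + 6 * (c x)\<^sup>2 * (\<Sum>l\<in>A. (c l)\<^sup>2) + 3 * (c x) ^ 4"
    using insert(3) by (intro add_mono) auto
  also have "\<dots> = 3 * (\<Sum>l\<in>insert x A. (c l)\<^sup>2)\<^sup>2"
    using insert(1,2) by (simp add: sq)
  finally show ?case .
qed (simp add: avg_def)

text \<open>Khintchine's lower bound. The polynomial \<open>z (z - s)\<^sup>2 (z + 2 s)\<close> is non-negative for \<open>z \<ge> 0\<close>, which bounds
\<open>\<bar>z\<bar>\<close> from below by a combination of \<open>z\<^sup>2\<close> and \<open>z\<^sup>4\<close>; the second and the fourth moment are known.\<close>

lemma rad_first_moment:
  assumes "finite A"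
  shows "sqrt (\<Sum>l\<in>A. (c l)\<^sup>2) \<le> 2 * avg (Pow A) (\<lambda>S. \<bar>\<Sum>l\<in>A. c l * rad S l\<bar>)"
proof (cases "(\<Sum>l\<in>A. (c l)\<^sup>2) = 0")
  case True
  then show ?thesis by (simp add: avg_def sum_nonneg)
next
  case False
  define V where "V = (\<Sum>l\<in>A. (c l)\<^sup>2)"
  \<comment> \<open>the scale at which the moments are compared: a fixed multiple of the standard deviation\<close>
  define s where "s = sqrt (2 * V)"
  have V: "V > 0" using False unfolding V_def by (simp add: order.not_eq_order_implies_strict sum_nonneg)
  then have s: "s > 0" "s\<^sup>2 = 2 * V" by (auto simp: s_def)
  have "3 * s\<^sup>2 * z\<^sup>2 + (-1) * z ^ 4 \<le> 2 * s ^ 3 * \<bar>z\<bar>" for z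
  proof -
    have "0 \<le> (\<bar>z\<bar> - s)\<^sup>2 * (\<bar>z\<bar> + 2 * s) * \<bar>z\<bar>"
      using s by (intro mult_nonneg_nonneg) auto
    also have "\<dots> = \<bar>z\<bar> ^ 4 - 3 * s\<^sup>2 * \<bar>z\<bar>\<^sup>2 + 2 * s ^ 3 * \<bar>z\<bar>"
      by (simp add: power4_eq_xxxx power3_eq_cube power2_eq_square algebra_simps del: abs_mult_self_eq)
    finally show ?thesis by simp
  qed
  then have "avg (Pow A) (\<lambda>S. 3 * s\<^sup>2 * (\<Sum>l\<in>A. c l * rad S l)\<^sup>2 + (-1) * (\<Sum>l\<in>A. c l * rad S l) ^ 4)
     \<le> avg (Pow A) (\<lambda>S. 2 * s ^ 3 * \<bar>\<Sum>l\<in>A. c l * rad S l\<bar>)"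
    by (intro avg_mono)
  then have "3 * s\<^sup>2 * V - avg (Pow A) (\<lambda>S. (\<Sum>l\<in>A. c l * rad S l) ^ 4)
     \<le> 2 * s ^ 3 * avg (Pow A) (\<lambda>S. \<bar>\<Sum>l\<in>A. c l * rad S l\<bar>)"
    unfolding avg_add avg_cmult by (simp add: rad_second_moment[OF assms] V_def)
  moreover have "avg (Pow A) (\<lambda>S. (\<Sum>l\<in>A. c l * rad S l) ^ 4) \<le> 3 * V\<^sup>2"
    unfolding V_def by (rule rad_fourth_moment[OF assms])
  ultimately have "3 * V\<^sup>2 \<le> 2 * s ^ 3 * avg (Pow A) (\<lambda>S. \<bar>\<Sum>l\<in>A. c l * rad S l\<bar>)"
    unfolding s(2) by (simp add: power2_eq_square)
  also have "\<dots> = 4 * V * (s * avg (Pow A) (\<lambda>S. \<bar>\<Sum>l\<in>A. c l * rad S l\<bar>))"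
    using s(2) by (simp add: power3_eq_cube power2_eq_square)
  finally have "3 * V \<le> 4 * (s * avg (Pow A) (\<lambda>S. \<bar>\<Sum>l\<in>A. c l * rad S l\<bar>))"
    using V by (simp add: power2_eq_square)
  moreover have "3 * V = sqrt V * (3 * sqrt V)" using V by simp
  moreover have "4 * (s * avg (Pow A) (\<lambda>S. \<bar>\<Sum>l\<in>A. c l * rad S l\<bar>))
      = sqrt V * (4 * sqrt 2 * avg (Pow A) (\<lambda>S. \<bar>\<Sum>l\<in>A. c l * rad S l\<bar>))"
    by (simp add: s_def real_sqrt_mult)
  ultimately have "sqrt V * (3 * sqrt V) \<le> sqrt V * (4 * sqrt 2 * avg (Pow A) (\<lambda>S. \<bar>\<Sum>l\<in>A. c l * rad S l\<bar>))"
    by linarith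
  then have "3 * sqrt V \<le> 4 * sqrt 2 * avg (Pow A) (\<lambda>S. \<bar>\<Sum>l\<in>A. c l * rad S l\<bar>)"
    using V by simp
  also have "\<dots> \<le> 6 * avg (Pow A) (\<lambda>S. \<bar>\<Sum>l\<in>A. c l * rad S l\<bar>)"
  proof (rule mult_right_mono)
    have "sqrt 2 \<le> sqrt ((3/2)\<^sup>2)" unfolding real_sqrt_le_iff by (simp add: power2_eq_square)
    then show "4 * sqrt 2 \<le> (6::real)" by simp
  qed (auto intro!: avg_nonneg)
  finally show ?thesis by (simp add: V_def)
qed

text \<open>Symmetrization and contraction for a single random element. An independent copy \<open>\<omega>'\<close> replaces the mean
of \<open>\<bar>x a \<omega>'\<bar>\<close>, after which the two copies are separated at the price of a factor 2. It remains to
remove the absolute values from \<open>P(2\<bar>x\<bar>) + P(-2\<bar>x\<bar>)\<close>, where \<open>P f\<close> is the maximum of \<open>u + f\<close>. The two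
maximisers \<open>a\<close> and \<open>b\<close> are compared with the signed values at \<open>\<omega>\<close> and at the reflected point \<open>\<nu> \<omega>\<close>,
which is equally likely. The offset \<open>u\<close> is arbitrary so that the step can be iterated.\<close>

lemma deviation_step:
  fixes x :: "'b \<Rightarrow> 'a \<Rightarrow> real"
  assumes S: "finite S" "S \<noteq> {}" and \<Omega>: "finite \<Omega>" "\<Omega> \<noteq> {}"
    and \<nu>: "bij_betw \<nu> \<Omega> \<Omega>" "\<And>a \<omega>. a \<in> S \<Longrightarrow> \<omega> \<in> \<Omega> \<Longrightarrow> x a (\<nu> \<omega>) = - x a \<omega>"
  shows "avg \<Omega> (\<lambda>\<omega>. MAX a\<in>S. u a + (avg \<Omega> (\<lambda>\<omega>'. \<bar>x a \<omega>'\<bar>) - \<bar>x a \<omega>\<bar>))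
      \<le> avg \<Omega> (\<lambda>\<omega>. MAX a\<in>S. u a + 2 * x a \<omega>)"
proof -
  define P where "P f = (MAX a\<in>S. u a + f a)" for f
  have P_ge: "u a + f a \<le> P f" if "a \<in> S" for a f
    unfolding P_def using S that by (intro Max_ge) auto
  have P_le: "P f \<le> c" if "\<And>a. a \<in> S \<Longrightarrow> u a + f a \<le> c" for f c
    unfolding P_def using S that by (subst Max_le_iff) auto
  have P_ex: "\<exists>a\<in>S. P f = u a + f a" for f
    using Max_in[of "(\<lambda>a. u a + f a) ` S"] S unfolding P_def by (auto simp: image_iff)
  \<comment> \<open>Jensen's inequality: the maximum of a mean is at most the mean of the maximum\<close>
  have "P (\<lambda>a. avg \<Omega> (\<lambda>\<omega>'. \<bar>x a \<omega>'\<bar>) - \<bar>x a \<omega>\<bar>) \<le> avg \<Omega> (\<lambda>\<omega>'. P (\<lambda>a. \<bar>x a \<omega>'\<bar> - \<bar>x a \<omega>\<bar>))" for \<omega>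
  proof (rule P_le)
    fix a assume a: "a \<in> S"
    have "u a + (avg \<Omega> (\<lambda>\<omega>'. \<bar>x a \<omega>'\<bar>) - \<bar>x a \<omega>\<bar>)
        = avg \<Omega> (\<lambda>\<omega>'. (u a + - \<bar>x a \<omega>\<bar>) + \<bar>x a \<omega>'\<bar>)"
      using \<Omega> by (subst avg_add) (simp add: avg_const)
    also have "\<dots> \<le> avg \<Omega> (\<lambda>\<omega>'. P (\<lambda>a. \<bar>x a \<omega>'\<bar> - \<bar>x a \<omega>\<bar>))"
    proof (rule avg_mono)
      fix \<omega>'
      show "(u a + - \<bar>x a \<omega>\<bar>) + \<bar>x a \<omega>'\<bar> \<le> P (\<lambda>a. \<bar>x a \<omega>'\<bar> - \<bar>x a \<omega>\<bar>)"
        using P_ge[OF a, of "\<lambda>a. \<bar>x a \<omega>'\<bar> - \<bar>x a \<omega>\<bar>"] by simp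
    qed
    finally show "u a + (avg \<Omega> (\<lambda>\<omega>'. \<bar>x a \<omega>'\<bar>) - \<bar>x a \<omega>\<bar>) \<le> \<dots>" .
  qed
  then have "avg \<Omega> (\<lambda>\<omega>. P (\<lambda>a. avg \<Omega> (\<lambda>\<omega>'. \<bar>x a \<omega>'\<bar>) - \<bar>x a \<omega>\<bar>))
     \<le> avg \<Omega> (\<lambda>\<omega>. avg \<Omega> (\<lambda>\<omega>'. P (\<lambda>a. \<bar>x a \<omega>'\<bar> - \<bar>x a \<omega>\<bar>)))"
    by (rule avg_mono)
  also have "\<dots> \<le> avg \<Omega> (\<lambda>\<omega>. avg \<Omega> (\<lambda>\<omega>'. 1/2 * P (\<lambda>a. 2 * \<bar>x a \<omega>'\<bar>) + 1/2 * P (\<lambda>a. - 2 * \<bar>x a \<omega>\<bar>)))"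
  proof (intro avg_mono P_le)
    fix a \<omega> \<omega>' assume "a \<in> S"
    then show "u a + (\<bar>x a \<omega>'\<bar> - \<bar>x a \<omega>\<bar>) \<le> 1/2 * P (\<lambda>a. 2 * \<bar>x a \<omega>'\<bar>) + 1/2 * P (\<lambda>a. - 2 * \<bar>x a \<omega>\<bar>)"
      using P_ge[of a "\<lambda>a. 2 * \<bar>x a \<omega>'\<bar>"] P_ge[of a "\<lambda>a. - 2 * \<bar>x a \<omega>\<bar>"] by linarith
  qed
  also have "\<dots> = avg \<Omega> (\<lambda>\<omega>. 1/2 * (P (\<lambda>a. 2 * \<bar>x a \<omega>\<bar>) + P (\<lambda>a. - 2 * \<bar>x a \<omega>\<bar>)))"
    by (simp only: avg_add avg_cmult avg_const[OF \<Omega>] distrib_left)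
  also have "\<dots> \<le> avg \<Omega> (\<lambda>\<omega>. 1/2 * (P (\<lambda>a. 2 * x a \<omega>) + P (\<lambda>a. 2 * x a (\<nu> \<omega>))))"
  proof (intro avg_mono mult_left_mono)
    fix \<omega> assume \<omega>: "\<omega> \<in> \<Omega>"
    \<comment> \<open>whatever the signs of \<open>x a \<omega>\<close> and \<open>x b \<omega>\<close>, one way of assigning \<open>a\<close> and \<open>b\<close> to \<open>\<omega>\<close> and \<open>\<nu> \<omega>\<close>
    yields at least \<open>2 \<bar>x a \<omega>\<bar> - 2 \<bar>x b \<omega>\<bar>\<close>\<close>
    obtain a b where a: "a \<in> S" "P (\<lambda>a. 2 * \<bar>x a \<omega>\<bar>) = u a + 2 * \<bar>x a \<omega>\<bar>"
      and b: "b \<in> S" "P (\<lambda>a. - 2 * \<bar>x a \<omega>\<bar>) = u b + - 2 * \<bar>x b \<omega>\<bar>"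
      using P_ex by meson
    show "P (\<lambda>a. 2 * \<bar>x a \<omega>\<bar>) + P (\<lambda>a. - 2 * \<bar>x a \<omega>\<bar>) \<le> P (\<lambda>a. 2 * x a \<omega>) + P (\<lambda>a. 2 * x a (\<nu> \<omega>))"
      using P_ge[OF a(1), of "\<lambda>a. 2 * x a \<omega>"] P_ge[OF a(1), of "\<lambda>a. 2 * x a (\<nu> \<omega>)"]
        P_ge[OF b(1), of "\<lambda>a. 2 * x a \<omega>"] P_ge[OF b(1), of "\<lambda>a. 2 * x a (\<nu> \<omega>)"]
        \<nu>(2)[OF a(1) \<omega>] \<nu>(2)[OF b(1) \<omega>]
      unfolding a(2) b(2) by linarith
  qed simp
  also have "\<dots> = 1/2 * (avg \<Omega> (\<lambda>\<omega>. P (\<lambda>a. 2 * x a \<omega>)) + avg \<Omega> (\<lambda>\<omega>. P (\<lambda>a. 2 * x a (\<nu> \<omega>))))"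
    unfolding avg_cmult avg_add ..
  also have "avg \<Omega> (\<lambda>\<omega>. P (\<lambda>a. 2 * x a (\<nu> \<omega>))) = avg \<Omega> (\<lambda>\<omega>. P (\<lambda>a. 2 * x a \<omega>))"
    unfolding avg_def using sum.reindex_bij_betw[OF \<nu>(1), of "\<lambda>\<omega>. P (\<lambda>a. 2 * x a \<omega>)"] by simp
  finally show ?thesis by (simp add: P_def)
qed

text \<open>The elements are exchanged one at a time. The summands of the other elements, whether already
exchanged or not, are part of the offset \<open>u\<close>.\<close>

lemma deviation_iterated:
  fixes x :: "'b \<Rightarrow> 'a \<Rightarrow> real"
  assumes S: "finite S" "S \<noteq> {}" and \<Omega>: "finite \<Omega>" "\<Omega> \<noteq> {}"
    and \<nu>: "bij_betw \<nu> \<Omega> \<Omega>" "\<And>a \<omega>. a \<in> S \<Longrightarrow> \<omega> \<in> \<Omega> \<Longrightarrow> x a (\<nu> \<omega>) = - x a \<omega>"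
  shows "iavg \<Omega> n (\<lambda>ws. MAX a\<in>S. u a + (\<Sum>\<omega>\<leftarrow>ws. avg \<Omega> (\<lambda>\<omega>'. \<bar>x a \<omega>'\<bar>) - \<bar>x a \<omega>\<bar>))
      \<le> iavg \<Omega> n (\<lambda>ws. MAX a\<in>S. u a + 2 * (\<Sum>\<omega>\<leftarrow>ws. x a \<omega>))"
proof (induction n arbitrary: u)
  case (Suc n)
  let ?d = "\<lambda>a \<omega>. avg \<Omega> (\<lambda>\<omega>'. \<bar>x a \<omega>'\<bar>) - \<bar>x a \<omega>\<bar>"
  have "iavg \<Omega> (Suc n) (\<lambda>ws. MAX a\<in>S. u a + (\<Sum>\<omega>\<leftarrow>ws. ?d a \<omega>))
      = avg \<Omega> (\<lambda>\<omega>. iavg \<Omega> n (\<lambda>ws. MAX a\<in>S. (u a + ?d a \<omega>) + (\<Sum>\<omega>\<leftarrow>ws. ?d a \<omega>)))"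
    by (simp add: add.assoc)
  also have "\<dots> \<le> avg \<Omega> (\<lambda>\<omega>. iavg \<Omega> n (\<lambda>ws. MAX a\<in>S. (u a + ?d a \<omega>) + 2 * (\<Sum>\<omega>\<leftarrow>ws. x a \<omega>)))"
    by (intro avg_mono Suc.IH)
  also have "\<dots> = iavg \<Omega> n (\<lambda>ws. avg \<Omega> (\<lambda>\<omega>. MAX a\<in>S. (u a + 2 * (\<Sum>\<omega>\<leftarrow>ws. x a \<omega>)) + ?d a \<omega>))"
    unfolding iavg_avg_swap by (simp add: algebra_simps)
  also have "\<dots> \<le> iavg \<Omega> n (\<lambda>ws. avg \<Omega> (\<lambda>\<omega>. MAX a\<in>S. (u a + 2 * (\<Sum>\<omega>\<leftarrow>ws. x a \<omega>)) + 2 * x a \<omega>))"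
    by (intro iavg_mono deviation_step[where \<nu> = \<nu>] assms)
  also have "\<dots> = iavg \<Omega> (Suc n) (\<lambda>ws. MAX a\<in>S. u a + 2 * (\<Sum>\<omega>\<leftarrow>ws. x a \<omega>))"
    unfolding iavg_avg_swap[symmetric] by (simp add: algebra_simps)
  finally show ?case .
qed simp

lemma sum_list_sum_swap:
  fixes f :: "'a \<Rightarrow> 'b \<Rightarrow> real"
  shows "(\<Sum>\<omega>\<leftarrow>ws. \<Sum>i\<in>I. c i * f i \<omega>) = (\<Sum>i\<in>I. c i * (\<Sum>\<omega>\<leftarrow>ws. f i \<omega>))"
  by (induction ws) (auto simp: sum.distrib distrib_left)

lemma power_le_exp:
  fixes z :: real
  assumes "0 \<le> z" "1 \<le> n"
  shows "z ^ n \<le> (real n / exp 1) ^ n * exp z"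
proof -
  have "z / real n \<le> exp (z / real n - 1)"
    using exp_ge_add_one_self[of "z / real n - 1"] by simp
  then have "(z / real n) ^ n \<le> exp (z / real n - 1) ^ n"
    using assms by (intro power_mono) auto
  also have "\<dots> = exp (real n * (z / real n - 1))" by (simp add: exp_of_nat_mult)
  also have "real n * (z / real n - 1) = z - real n" using assms by (simp add: field_simps)
  finally have "z ^ n \<le> real n ^ n * exp (z - real n)"
    using assms by (simp add: power_divide field_simps)
  also have "exp (z - real n) = exp z / exp 1 ^ n" by (simp add: exp_diff exp_of_nat_mult[symmetric])
  finally show ?thesis by (simp add: power_divide field_simps)
qed

text \<open>Markov's argument with the even function \<open>exp(l y) + exp(-l y)\<close>, which dominates \<open>y\<^sup>2\<^sup>m\<close> up to a
constant; \<open>l\<^sup>2 = 2 m / s\<close> is the optimal choice. This is where the factor \<open>q\<^sup>1\<^sup>/\<^sup>2\<close> of the final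
estimate comes from.\<close>

lemma subgaussian_even_moment:
  assumes mgf: "\<And>l. iavg \<Omega> n (\<lambda>ws. exp (l * Y ws)) \<le> exp (l\<^sup>2 * s / 2)"
    and "0 < s" "1 \<le> m"
  shows "iavg \<Omega> n (\<lambda>ws. Y ws ^ (2 * m)) \<le> (2 * real m * s) ^ m"
proof -
  define l where "l = sqrt (2 * real m / s)"
  have l: "l > 0" "l\<^sup>2 = 2 * real m / s" using assms by (auto simp: l_def)
  define c where "c = (2 * real m / (exp 1 * l)) ^ (2 * m)"
  have c: "c \<ge> 0" using l by (simp add: c_def)
  have "y ^ (2 * m) \<le> c * exp (l * y) + c * exp (- l * y)" for y
  proof -
    have "(l * \<bar>y\<bar>) ^ (2 * m) \<le> (2 * real m / exp 1) ^ (2 * m) * exp (l * \<bar>y\<bar>)"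
      using power_le_exp[of "l * \<bar>y\<bar>" "2 * m"] l assms by simp
    then have "\<bar>y\<bar> ^ (2 * m) \<le> c * exp (l * \<bar>y\<bar>)"
      using l unfolding c_def by (simp add: power_mult_distrib power_divide field_simps)
    also have "\<dots> \<le> c * (exp (l * y) + exp (- l * y))"
      using c by (intro mult_left_mono) (auto simp: abs_if)
    finally show ?thesis by (simp add: power_even_abs distrib_left)
  qed
  then have "iavg \<Omega> n (\<lambda>ws. Y ws ^ (2 * m)) \<le> iavg \<Omega> n (\<lambda>ws. c * exp (l * Y ws) + c * exp (- l * Y ws))"
    by (intro iavg_mono)
  also have "\<dots> \<le> c * exp (l\<^sup>2 * s / 2) + c * exp (l\<^sup>2 * s / 2)"
    unfolding iavg_add iavg_cmult using mgf[of l] mgf[of "- l"] c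
    by (intro add_mono mult_left_mono) auto
  also have "\<dots> = 2 * c * exp 1 ^ m"
    using assms by (simp add: l(2) exp_of_nat_mult[symmetric])
  also have "\<dots> = 2 * (2 * real m * s / exp 1) ^ m"
  proof -
    have "c = (2 * real m * s / (exp 1 * exp 1)) ^ m"
    proof -
      have "(2 * real m / (exp 1 * l))\<^sup>2 = 4 * (real m)\<^sup>2 / ((exp 1)\<^sup>2 * l\<^sup>2)"
        by (simp add: power_divide power_mult_distrib)
      also have "\<dots> = 2 * real m * s / (exp 1 * exp 1)"
        unfolding l(2) using assms by (simp add: power2_eq_square field_simps)
      finally show ?thesis by (simp only: c_def power_mult)
    qed
    then show ?thesis by (simp add: power_divide power_mult_distrib)
  qed
  also have "\<dots> \<le> (2 * real m * s) ^ m"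
  proof -
    have "(2::real) \<le> exp 1" using exp_ge_add_one_self[of "1::real"] by simp
    also have "\<dots> \<le> exp 1 ^ m" using assms by (intro self_le_power) auto
    finally have "2 * (2 * real m * s) ^ m \<le> exp 1 ^ m * (2 * real m * s) ^ m"
      using assms by (intro mult_right_mono) auto
    then show ?thesis by (simp add: power_divide field_simps)
  qed
  finally show ?thesis .
qed

text \<open>A substitute for Hoelder's inequality between the exponents \<open>2 m\<close> and \<open>2 m / (2 m - 1)\<close> that avoids roots
and is just as good up to a constant, once both factors are normalised.\<close>

lemma power_pred_mult_le:
  fixes a b :: real
  assumes "1 \<le> m"
  shows "a ^ (2 * m - 1) * b \<le> a ^ (2 * m) + b ^ (2 * m)"
proof -
  have p: "a ^ (2 * m - 1) * a = a ^ (2 * m)" for a :: real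
    using assms by (intro power_minus_mult) simp
  have "a ^ (2 * m - 1) * b \<le> \<bar>a\<bar> ^ (2 * m - 1) * \<bar>b\<bar>"
    using abs_ge_self[of "a ^ (2 * m - 1) * b"] by (simp add: abs_mult power_abs)
  also have "\<dots> \<le> \<bar>a\<bar> ^ (2 * m) + \<bar>b\<bar> ^ (2 * m)"
  proof (cases "\<bar>a\<bar> \<le> \<bar>b\<bar>")
    case True
    then have "\<bar>a\<bar> ^ (2 * m - 1) * \<bar>b\<bar> \<le> \<bar>b\<bar> ^ (2 * m - 1) * \<bar>b\<bar>"
      by (intro mult_right_mono power_mono) auto
    also have "\<dots> = \<bar>b\<bar> ^ (2 * m)" by (rule p)
    finally show ?thesis by (smt (verit) zero_le_power abs_ge_zero)
  next
    case False
    then have "\<bar>a\<bar> ^ (2 * m - 1) * \<bar>b\<bar> \<le> \<bar>a\<bar> ^ (2 * m - 1) * \<bar>a\<bar>"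
      by (intro mult_left_mono) auto
    also have "\<dots> = \<bar>a\<bar> ^ (2 * m)" by (rule p)
    finally show ?thesis by (smt (verit) zero_le_power abs_ge_zero)
  qed
  also have "\<dots> = a ^ (2 * m) + b ^ (2 * m)" by (simp add: power_even_abs)
  finally show ?thesis .
qed

text \<open>The image of the dual ball under the adjoint is parametrised as \<open>l \<mapsto> \<Sum>i. r\<^sub>i\<^sup>2\<^sup>m\<^sup>-\<^sup>1 W\<^sub>i\<^sub>l\<close> where \<open>r\<close> has
normalised \<open>2 m\<close>-norm at most 1, because powers \<open>r\<^sup>2\<^sup>m\<^sup>-\<^sup>1\<close> are precisely the functionals needed later.
For a good choice of \<open>n\<close> sign vectors, \<open>n\<close> times the norm of any of these points is at most twice
the sum of its absolute inner products with the sign vectors, up to an error of order \<open>n\<^sup>1\<^sup>/\<^sup>2\<close>.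

The deviation inequality provides such a choice simultaneously for finitely many \<open>r\<close>. This is enough: there
are only finitely many choices of sign vectors, and if each of them failed for some \<open>r\<close>, these finitely
many \<open>r\<close> would contradict it.\<close>

lemma low_Mstar_estimate:
  fixes W :: "nat \<Rightarrow> nat \<Rightarrow> real"
  assumes "1 \<le> N" "1 \<le> m" "1 \<le> n" "0 < \<rho>"
    and W: "\<And>i. i < N \<Longrightarrow> (\<Sum>l<N. (W i l)\<^sup>2) \<le> \<rho>\<^sup>2"
  defines "X \<equiv> \<lambda>i \<omega>. \<Sum>l<N. W i l * rad \<omega> l"
  shows "\<exists>ws. length ws = n \<and> (\<forall>r. (\<Sum>i<N. r i ^ (2 * m)) \<le> real N \<longrightarrow>
     real n * sqrt (\<Sum>l<N. (\<Sum>i<N. r i ^ (2 * m - 1) * W i l)\<^sup>2)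
       \<le> 2 * ((\<Sum>\<omega>\<leftarrow>ws. \<bar>\<Sum>i<N. r i ^ (2 * m - 1) * X i \<omega>\<bar>) + 4 * real N * sqrt (2 * real m * real n) * \<rho>))"
proof -
  define \<Omega> where "\<Omega> = Pow {..<N}"
  have \<Omega>: "finite \<Omega>" "\<Omega> \<noteq> {}" by (auto simp: \<Omega>_def)
  define x where "x r \<omega> = (\<Sum>i<N. r i ^ (2 * m - 1) * X i \<omega>)" for r :: "nat \<Rightarrow> real" and \<omega>
  have x_eq: "x r \<omega> = (\<Sum>l<N. (\<Sum>i<N. r i ^ (2 * m - 1) * W i l) * rad \<omega> l)" for r \<omega>
    unfolding x_def X_def sum_distrib_left sum_distrib_right
    by (subst sum.swap) (simp add: mult.assoc)
  define A where "A = sqrt (2 * real m * real n) * \<rho>"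
  have A: "A > 0" using assms by (simp add: A_def)
  define dev where "dev r ws = (\<Sum>\<omega>\<leftarrow>ws. avg \<Omega> (\<lambda>\<omega>'. \<bar>x r \<omega>'\<bar>) - \<bar>x r \<omega>\<bar>)" for r ws
  define \<nu> where "\<nu> \<omega> = {..<N} - \<omega>" for \<omega>
  have \<nu>: "bij_betw \<nu> \<Omega> \<Omega>"
    unfolding \<Omega>_def by (rule bij_betw_byWitness[where f' = \<nu>]) (auto simp: \<nu>_def)
  have x_neg: "x r (\<nu> \<omega>) = - x r \<omega>" if "\<omega> \<in> \<Omega>" for r \<omega>
    using that unfolding x_eq \<nu>_def \<Omega>_def by (intro rad_sum_compl) auto
  \<comment> \<open>\<open>A\<close> is the size of the sums of \<open>n\<close> signed rows in the \<open>2 m\<close>-th mean\<close>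
  have Y: "iavg \<Omega> n (\<lambda>ws. ((\<Sum>\<omega>\<leftarrow>ws. X i \<omega>) / A) ^ (2 * m)) \<le> 1" if "i < N" for i
  proof -
    have "iavg \<Omega> n (\<lambda>ws. exp (l * (\<Sum>\<omega>\<leftarrow>ws. X i \<omega>))) \<le> exp (l\<^sup>2 * (real n * \<rho>\<^sup>2) / 2)" for l
    proof -
      have "iavg \<Omega> n (\<lambda>ws. exp (l * (\<Sum>\<omega>\<leftarrow>ws. X i \<omega>)))
          = avg \<Omega> (\<lambda>\<omega>. exp (\<Sum>k<N. (l * W i k) * rad \<omega> k)) ^ n"
        unfolding sum_list_const_mult[symmetric] iavg_exp_sum X_def
        by (simp add: sum_distrib_left mult.assoc)
      also have "\<dots> \<le> exp ((\<Sum>k<N. (l * W i k)\<^sup>2) / 2) ^ n"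
        unfolding \<Omega>_def by (intro power_mono rad_mgf avg_nonneg) auto
      also have "\<dots> \<le> exp (l\<^sup>2 * \<rho>\<^sup>2 / 2) ^ n"
        using W[OF that]
        by (intro power_mono) (auto simp: power_mult_distrib sum_distrib_left[symmetric] intro!: mult_left_mono)
      also have "\<dots> = exp (l\<^sup>2 * (real n * \<rho>\<^sup>2) / 2)"
        by (simp add: exp_of_nat_mult[symmetric] mult_ac)
      finally show ?thesis .
    qed
    then have "iavg \<Omega> n (\<lambda>ws. (\<Sum>\<omega>\<leftarrow>ws. X i \<omega>) ^ (2 * m)) \<le> (2 * real m * (real n * \<rho>\<^sup>2)) ^ m"
      using assms by (intro subgaussian_even_moment) auto
    also have "2 * real m * (real n * \<rho>\<^sup>2) = A\<^sup>2" using assms by (simp add: A_def power_mult_distrib)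
    finally have "iavg \<Omega> n (\<lambda>ws. (\<Sum>\<omega>\<leftarrow>ws. X i \<omega>) ^ (2 * m)) \<le> A ^ (2 * m)" by (simp add: power_mult)
    moreover have "iavg \<Omega> n (\<lambda>ws. ((\<Sum>\<omega>\<leftarrow>ws. X i \<omega>) / A) ^ (2 * m))
        = 1 / A ^ (2 * m) * iavg \<Omega> n (\<lambda>ws. (\<Sum>\<omega>\<leftarrow>ws. X i \<omega>) ^ (2 * m))"
      unfolding iavg_cmult[symmetric] by (simp add: power_divide)
    moreover have "1 / A ^ (2 * m) * A ^ (2 * m) = 1" using A by simp
    ultimately show ?thesis using A by (metis mult_left_mono zero_le_divide_1_iff zero_le_power less_imp_le)
  qed
  define ball where "ball = {r :: nat \<Rightarrow> real. (\<Sum>i<N. r i ^ (2 * m)) \<le> real N}"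
  have fin: "\<exists>ws. set ws \<subseteq> \<Omega> \<and> length ws = n \<and>
      (\<forall>r\<in>S. dev r ws \<le> 4 * real N * A)"
    if S: "finite S" "S \<noteq> {}" "S \<subseteq> ball" for S
  proof -
    let ?F = "\<lambda>ws. MAX r\<in>S. 0 + dev r ws"
    obtain ws where ws: "set ws \<subseteq> \<Omega>" "length ws = n" "?F ws \<le> iavg \<Omega> n ?F"
      using iavg_attained[OF \<Omega>, of n ?F] by auto
    note ws(3)
    also have "iavg \<Omega> n ?F \<le> iavg \<Omega> n (\<lambda>ws. MAX r\<in>S. 0 + 2 * (\<Sum>\<omega>\<leftarrow>ws. x r \<omega>))"
      unfolding dev_def
      by (rule deviation_iterated[where x = x and \<nu> = \<nu> and u = "\<lambda>_. 0"]) (use S \<Omega> \<nu> x_neg in auto)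
    also have "\<dots> \<le> iavg \<Omega> n (\<lambda>ws. 2 * A * (real N + (\<Sum>i<N. ((\<Sum>\<omega>\<leftarrow>ws. X i \<omega>) / A) ^ (2 * m))))"
    proof (intro iavg_mono Max.boundedI)
      fix ws z assume "z \<in> (\<lambda>r. 0 + 2 * (\<Sum>\<omega>\<leftarrow>ws. x r \<omega>)) ` S"
      then obtain r where r: "r \<in> ball" "z = 2 * (\<Sum>\<omega>\<leftarrow>ws. x r \<omega>)" using S by auto
      let ?Y = "\<lambda>i. (\<Sum>\<omega>\<leftarrow>ws. X i \<omega>)"
      \<comment> \<open>linearity allows to sum the sign vectors before pairing with \<open>r\<^sup>2\<^sup>m\<^sup>-\<^sup>1\<close>\<close>
      have "(\<Sum>\<omega>\<leftarrow>ws. x r \<omega>) = A * (\<Sum>i<N. r i ^ (2 * m - 1) * (?Y i / A))"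
        unfolding x_def sum_list_sum_swap using A by (simp add: sum_distrib_left)
      also have "\<dots> \<le> A * (\<Sum>i<N. r i ^ (2 * m) + (?Y i / A) ^ (2 * m))"
        using A assms by (intro mult_left_mono sum_mono power_pred_mult_le) auto
      also have "\<dots> \<le> A * (real N + (\<Sum>i<N. (?Y i / A) ^ (2 * m)))"
        using A r by (auto simp: ball_def sum.distrib intro!: mult_left_mono)
      finally show "z \<le> 2 * A * (real N + (\<Sum>i<N. (?Y i / A) ^ (2 * m)))"
        by (simp add: r)
    qed (use S in auto)
    also have "\<dots> = 2 * A * (real N + (\<Sum>i<N. iavg \<Omega> n (\<lambda>ws. ((\<Sum>\<omega>\<leftarrow>ws. X i \<omega>) / A) ^ (2 * m))))"
      using \<Omega> by (simp add: iavg_cmult iavg_add iavg_const iavg_sum)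
    also have "\<dots> \<le> 2 * A * (real N + (\<Sum>i<N. 1))"
      using A Y by (intro mult_left_mono add_left_mono sum_mono) auto
    finally have "?F ws \<le> 4 * real N * A" by (simp add: mult_ac)
    then have "\<forall>r\<in>S. dev r ws \<le> 4 * real N * A"
      using S by (subst (asm) Max_le_iff) auto
    with ws show ?thesis by blast
  qed
  have "\<exists>ws. set ws \<subseteq> \<Omega> \<and> length ws = n \<and>
      (\<forall>r\<in>ball. dev r ws \<le> 4 * real N * A)"
  proof (rule ccontr)
    assume "\<not> ?thesis"
    then have "\<exists>r. set ws \<subseteq> \<Omega> \<and> length ws = n \<longrightarrow> r \<in> ball \<and> \<not> dev r ws \<le> 4 * real N * A" for ws
      by blast
    then obtain h where h: "\<And>ws. set ws \<subseteq> \<Omega> \<Longrightarrow> length ws = n \<Longrightarrow> h ws \<in> ball \<and>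
       \<not> dev (h ws) ws \<le> 4 * real N * A"
      by metis
    obtain \<omega>0 where "\<omega>0 \<in> \<Omega>" using \<Omega> by auto
    then have "replicate n \<omega>0 \<in> {ws. set ws \<subseteq> \<Omega> \<and> length ws = n}" by auto
    then have "\<exists>ws. set ws \<subseteq> \<Omega> \<and> length ws = n \<and>
      (\<forall>r\<in>h ` {ws. set ws \<subseteq> \<Omega> \<and> length ws = n}. 
        dev r ws \<le> 4 * real N * A)"
      using h by (intro fin finite_imageI finite_lists_length_eq \<Omega>) auto
    with h show False by blast
  qed
  then obtain ws where ws: "set ws \<subseteq> \<Omega>" "length ws = n"
    "\<And>r. r \<in> ball \<Longrightarrow> dev r ws \<le> 4 * real N * A"
    by blast
  show ?thesis
  proof (intro exI[of _ ws] conjI allI impI ws(2))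
    fix r :: "nat \<Rightarrow> real" assume "(\<Sum>i<N. r i ^ (2 * m)) \<le> real N"
    then have r: "r \<in> ball" by (simp add: ball_def)
    have "real n * sqrt (\<Sum>l<N. (\<Sum>i<N. r i ^ (2 * m - 1) * W i l)\<^sup>2) \<le> real n * (2 * avg \<Omega> (\<lambda>\<omega>. \<bar>x r \<omega>\<bar>))"
      unfolding x_eq \<Omega>_def by (intro mult_left_mono rad_first_moment) auto
    also have "\<dots> = 2 * ((\<Sum>\<omega>\<leftarrow>ws. \<bar>x r \<omega>\<bar>) + dev r ws)"
      by (simp add: dev_def ws(2) sum_list_subtractf sum_list_triv)
    also have "\<dots> \<le> 2 * ((\<Sum>\<omega>\<leftarrow>ws. \<bar>x r \<omega>\<bar>) + 4 * real N * A)"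
      by (intro mult_left_mono add_left_mono ws(3)[OF r]) simp
    finally show "real n * sqrt (\<Sum>l<N. (\<Sum>i<N. r i ^ (2 * m - 1) * W i l)\<^sup>2)
       \<le> 2 * ((\<Sum>\<omega>\<leftarrow>ws. \<bar>\<Sum>i<N. r i ^ (2 * m - 1) * X i \<omega>\<bar>) + 4 * real N * sqrt (2 * real m * real n) * \<rho>)"
      by (simp add: x_def A_def mult.assoc)
  qed
qed

section \<open>Kolmogorov widths of finitely many vectors in a Hilbert space\<close>

text \<open>Cholesky factorization of a positive semidefinite matrix, eliminating the last index. If the
pivot \<open>d\<close> vanishes, then so does its column, and all divisions by \<open>d\<close> have the value 0, so both cases
share the same formulas.\<close>

lemma gram_factorization:
  fixes G :: "nat \<Rightarrow> nat \<Rightarrow> real"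
  assumes "\<And>i j. i < N \<Longrightarrow> j < N \<Longrightarrow> G i j = G j i"
    and "\<And>\<phi>. 0 \<le> (\<Sum>i<N. \<Sum>j<N. \<phi> i * \<phi> j * G i j)"
  shows "\<exists>W. \<forall>i<N. \<forall>j<N. G i j = (\<Sum>l<N. W i l * W j l)"
  using assms
proof (induction N arbitrary: G)
  case (Suc N)
  note sym = Suc.prems(1) and psd = Suc.prems(2)
  define d where "d = G N N"
  have form: "(\<Sum>i<Suc N. \<Sum>j<Suc N. \<phi> i * \<phi> j * G i j)
      = (\<Sum>i<N. \<Sum>j<N. \<phi> i * \<phi> j * G i j) + 2 * \<phi> N * (\<Sum>i<N. \<phi> i * G i N) + (\<phi> N)\<^sup>2 * d" for \<phi>
  proof -
    have "(\<Sum>j<N. \<phi> N * \<phi> j * G N j) = (\<Sum>i<N. \<phi> N * (\<phi> i * G i N))"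
      by (intro sum.cong) (auto simp: sym[of N])
    moreover have "(\<Sum>i<N. \<phi> i * \<phi> N * G i N) = (\<Sum>i<N. \<phi> N * (\<phi> i * G i N))"
      by (intro sum.cong) auto
    ultimately show ?thesis
      by (simp add: sum.distrib sum_distrib_left[symmetric] d_def power2_eq_square)
  qed
  have d: "0 \<le> d"
    using psd[of "\<lambda>i. if i = N then 1 else 0"] unfolding form by simp
  have zero: "G i N = 0" if "d = 0" "i < N" for i
  proof (rule ccontr)
    assume nz: "G i N \<noteq> 0"
    let ?\<phi> = "\<lambda>c k. if k = N then c else if k = i then (1::real) else 0"
    have "(\<Sum>k<N. \<Sum>j<N. ?\<phi> c k * ?\<phi> c j * G k j) = G i i" for c
    proof -
      have "(\<Sum>k<N. \<Sum>j<N. ?\<phi> c k * ?\<phi> c j * G k j) = (\<Sum>k<N. \<Sum>j<N. if j = i then (if k = i then G k j else 0) else 0)"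
        by (intro sum.cong) auto
      also have "\<dots> = G i i" using that by (simp add: sum.delta)
      finally show ?thesis .
    qed
    moreover have "(\<Sum>k<N. ?\<phi> c k * G k N) = G i N" for c
    proof -
      have "(\<Sum>k<N. ?\<phi> c k * G k N) = (\<Sum>k<N. if k = i then G k N else 0)"
        by (intro sum.cong) auto
      then show ?thesis using that by (simp add: sum.delta)
    qed
    ultimately have "0 \<le> G i i + 2 * c * G i N" for c
      using psd[of "?\<phi> c"] unfolding form by (simp add: that)
    \<comment> \<open>a non-constant affine function of \<open>c\<close> takes negative values\<close>
    from this[of "- (G i i + 1) / (2 * G i N)"] nz show False by (simp add: field_simps)
  qed
  define G' where "G' i j = G i j - G i N * G j N / d" for i j
  have "\<exists>W. \<forall>i<N. \<forall>j<N. G' i j = (\<Sum>l<N. W i l * W j l)"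
  proof (rule Suc.IH)
    show "G' i j = G' j i" if "i < N" "j < N" for i j
      using sym[of i j] that by (simp add: G'_def)
  next
    fix \<phi> :: "nat \<Rightarrow> real"
    define b where "b = (\<Sum>i<N. \<phi> i * G i N)"
    \<comment> \<open>the last coordinate minimises the quadratic form, which yields the Schur complement\<close>
    let ?\<psi> = "\<lambda>i. if i = N then - b / d else \<phi> i"
    have "(\<Sum>i<N. \<Sum>j<N. \<phi> i * \<phi> j * G' i j) = (\<Sum>i<N. \<Sum>j<N. \<phi> i * \<phi> j * G i j) - b * b / d"
      unfolding b_def sum_product G'_def
      by (simp add: algebra_simps sum_subtractf sum_divide_distrib)
    also have "\<dots> = (\<Sum>i<Suc N. \<Sum>j<Suc N. ?\<psi> i * ?\<psi> j * G i j)"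
      unfolding form by (simp add: b_def[symmetric] power2_eq_square)
    finally show "0 \<le> (\<Sum>i<N. \<Sum>j<N. \<phi> i * \<phi> j * G' i j)" using psd[of ?\<psi>] by simp
  qed
  then obtain W where W: "\<And>i j. i < N \<Longrightarrow> j < N \<Longrightarrow> G' i j = (\<Sum>l<N. W i l * W j l)" by blast
  define W' where "W' i l = (if l = N then G i N / sqrt d else if i = N then 0 else W i l)" for i l
  have "G i j = (\<Sum>l<Suc N. W' i l * W' j l)" if ij: "i < Suc N" "j < Suc N" for i j
  proof -
    have last: "W' i N * W' j N = G i N * G j N / d" 
      using d by (simp add: W'_def)
    have dd: "G N N * G N N / d = G N N" "G i N * d / d = G i N" if "i < N" for i
      using zero[OF _ that] by (auto simp: d_def)
    consider "i < N" "j < N" | "i = N" "j < N" | "i < N" "j = N" | "i = N" "j = N"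
      using ij by linarith
    then show ?thesis
    proof cases
      case 1
      have "(\<Sum>l<N. W' i l * W' j l) = G' i j"
        using 1 unfolding W[OF 1] by (intro sum.cong) (auto simp: W'_def)
      then show ?thesis using last by (simp add: G'_def)
    next
      case 2
      then show ?thesis using last zero[of j] sym[of N j] by (auto simp: W'_def d_def)
    next
      case 3
      then show ?thesis using last zero[of i] by (auto simp: W'_def d_def)
    next
      case 4
      then show ?thesis using last by (auto simp: W'_def d_def)
    qed
  qed
  then show ?case by blast
qed simp

text \<open>Taylor's formula of first order with a remainder that is uniform on bounded sets.\<close>

lemma power_taylor_bound:
  fixes B :: real
  shows "\<exists>C\<ge>0. \<forall>r w s. \<bar>r\<bar> \<le> B \<longrightarrow> \<bar>w\<bar> \<le> B \<longrightarrow> 0 \<le> s \<longrightarrow> s \<le> 1 \<longrightarrow>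
     \<bar>(r - s * w) ^ k - r ^ k + real k * s * w * r ^ (k - 1)\<bar> \<le> C * s\<^sup>2"
proof (induction k)
  case 0
  show ?case by (intro exI[of _ 0]) auto
next
  case (Suc k)
  then obtain C where C: "C \<ge> 0" and IH: "\<And>r w s. \<bar>r\<bar> \<le> B \<Longrightarrow> \<bar>w\<bar> \<le> B \<Longrightarrow> 0 \<le> s \<Longrightarrow> s \<le> 1 \<Longrightarrow>
     \<bar>(r - s * w) ^ k - r ^ k + real k * s * w * r ^ (k - 1)\<bar> \<le> C * s\<^sup>2" by blast
  define C' where "C' = 2 * \<bar>B\<bar> * C + real k * \<bar>B\<bar>\<^sup>2 * \<bar>B\<bar> ^ (k - 1)"
  show ?case
  proof (intro exI[of _ C'] conjI allI impI)
    show "0 \<le> C'" using C by (simp add: C'_def)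
    fix r w s :: real assume h: "\<bar>r\<bar> \<le> B" "\<bar>w\<bar> \<le> B" "0 \<le> s" "s \<le> 1"
    define e where "e = (r - s * w) ^ k - r ^ k + real k * s * w * r ^ (k - 1)"
    have e: "\<bar>e\<bar> \<le> C * s\<^sup>2" unfolding e_def using IH[OF h] .
    have k: "real k * r ^ k = real k * r * r ^ (k - 1)" by (cases k) auto
    have "(r - s * w) ^ Suc k = (r - s * w) * (e + r ^ k - real k * s * w * r ^ (k - 1))"
      by (simp add: e_def)
    also have "\<dots> = (r - s * w) * e + r ^ Suc k - s * w * r ^ k - real k * r * r ^ (k - 1) * (s * w)
          + real k * s\<^sup>2 * w\<^sup>2 * r ^ (k - 1)"
      by (simp add: power2_eq_square algebra_simps)
    also have "\<dots> = (r - s * w) * e + r ^ Suc k - real (Suc k) * s * w * r ^ k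
          + real k * s\<^sup>2 * w\<^sup>2 * r ^ (k - 1)"
      unfolding k[symmetric] by (simp add: algebra_simps)
    finally have "(r - s * w) ^ Suc k - r ^ Suc k + real (Suc k) * s * w * r ^ (Suc k - 1)
        = (r - s * w) * e + s\<^sup>2 * (real k * w\<^sup>2 * r ^ (k - 1))" by simp
    also have "\<bar>\<dots>\<bar> \<le> (2 * \<bar>B\<bar>) * (C * s\<^sup>2) + s\<^sup>2 * (real k * \<bar>B\<bar>\<^sup>2 * \<bar>B\<bar> ^ (k - 1))"
    proof (intro order_trans[OF abs_triangle_ineq] add_mono)
      have "\<bar>s * w\<bar> \<le> 1 * B" unfolding abs_mult using h by (intro mult_mono) auto
      then have "\<bar>r - s * w\<bar> \<le> 2 * \<bar>B\<bar>" using h by linarith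
      then show "\<bar>(r - s * w) * e\<bar> \<le> 2 * \<bar>B\<bar> * (C * s\<^sup>2)"
        unfolding abs_mult using e by (intro mult_mono) auto
      have "\<bar>w\<bar>\<^sup>2 \<le> \<bar>B\<bar>\<^sup>2" by (rule power_mono) (use h in auto)
      moreover have "\<bar>r\<bar> ^ (k - 1) \<le> \<bar>B\<bar> ^ (k - 1)" by (rule power_mono) (use h in auto)
      ultimately show "\<bar>s\<^sup>2 * (real k * w\<^sup>2 * r ^ (k - 1))\<bar> \<le> s\<^sup>2 * (real k * \<bar>B\<bar>\<^sup>2 * \<bar>B\<bar> ^ (k - 1))"
        unfolding abs_mult power_abs by (intro mult_mono) auto
    qed
    also have "\<dots> = C' * s\<^sup>2" by (simp add: C'_def algebra_simps)
    finally show "\<bar>(r - s * w) ^ Suc k - r ^ Suc k + real (Suc k) * s * w * r ^ (Suc k - 1)\<bar> \<le> C' * s\<^sup>2" .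
  qed
qed

text \<open>\<open>R\<close> consists of the residuals when \<open>y\<close> is approximated by combinations of \<open>v\<close>, and \<open>r\<^sup>2\<^sup>m\<^sup>-\<^sup>1\<close> is, up to
a factor, the gradient of \<open>\<Sum>i. r\<^sub>i\<^sup>2\<^sup>m\<close>. At a minimiser it annihilates all \<open>v\<^sub>j\<close>. A residual \<open>r\<close> within \<open>\<eta>\<close> of the infimum
spares a compactness argument: a step of length \<open>\<eta>\<^sup>1\<^sup>/\<^sup>2\<close> in any direction changes the functional to
first order by the gradient and otherwise by \<open>O(\<eta>)\<close>, and cannot fall below the infimum; hence the gradient
is \<open>O(\<eta>\<^sup>1\<^sup>/\<^sup>2)\<close>. The direction \<open>y - r\<close> is listed separately since the coefficients of \<open>y - r\<close> in
terms of \<open>v\<close> need not stay bounded as \<open>\<eta>\<close> tends to 0.\<close>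

lemma almost_dual_functional:
  fixes y :: "nat \<Rightarrow> real" and v :: "nat \<Rightarrow> nat \<Rightarrow> real" and p N :: nat
  assumes "1 \<le> m"
  defines "R \<equiv> {r. \<exists>a. \<forall>i. r i = y i - (\<Sum>j<p. a j * v j i)}"
  defines "\<Delta> \<equiv> Inf ((\<lambda>r. \<Sum>i<N. r i ^ (2 * m)) ` R)"
  shows "\<exists>C\<ge>0. \<forall>\<eta>. 0 < \<eta> \<longrightarrow> \<eta> \<le> 1 \<longrightarrow> (\<exists>r\<in>R.
     \<Delta> \<le> (\<Sum>i<N. r i ^ (2 * m)) \<and> (\<Sum>i<N. r i ^ (2 * m)) \<le> \<Delta> + \<eta> \<and>
     (\<forall>j<p. \<bar>\<Sum>i<N. r i ^ (2 * m - 1) * v j i\<bar> \<le> C * sqrt \<eta>) \<and>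
     \<bar>\<Sum>i<N. r i ^ (2 * m - 1) * (y i - r i)\<bar> \<le> C * sqrt \<eta>)"
proof -
  define \<Psi> where "\<Psi> r = (\<Sum>i<N. r i ^ (2 * m))" for r :: "nat \<Rightarrow> real"
  have \<Psi>0: "0 \<le> \<Psi> r" for r unfolding \<Psi>_def by (intro sum_nonneg) auto
  have yR: "y \<in> R" unfolding R_def by (auto intro!: exI[of _ "\<lambda>_. 0"])
  have low: "\<Delta> \<le> \<Psi> r" if "r \<in> R" for r
    unfolding \<Delta>_def \<Psi>_def[symmetric] using that \<Psi>0 by (intro cINF_lower) (auto intro!: bdd_belowI2[where m = 0])
  have near: "\<exists>r\<in>R. \<Psi> r \<le> \<Delta> + \<eta>" if "0 < \<eta>" for \<eta>
  proof -
    have "Inf (\<Psi> ` R) < \<Delta> + \<eta>" using that by (simp add: \<Delta>_def \<Psi>_def)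
    then have "\<exists>x\<in>\<Psi> ` R. x < \<Delta> + \<eta>"
      using yR \<Psi>0 by (subst (asm) cInf_less_iff) (auto intro!: bdd_belowI2[where m = 0])
    then show ?thesis by (auto intro: less_imp_le)
  qed
  have \<Delta>0: "0 \<le> \<Delta>" unfolding \<Delta>_def \<Psi>_def[symmetric] using yR \<Psi>0 by (intro cINF_greatest) auto
  define Br where "Br = \<Delta> + 2"
  define B where "B = Br + (\<Sum>i<N. \<bar>y i\<bar>) + (\<Sum>j<p. \<Sum>i<N. \<bar>v j i\<bar>)"
  have y_le: "\<bar>y i\<bar> \<le> (\<Sum>i<N. \<bar>y i\<bar>)" if "i < N" for i
    using that by (intro member_le_sum[where f = "\<lambda>i. \<bar>y i\<bar>"]) auto
  have v_le: "\<bar>v j i\<bar> \<le> (\<Sum>j<p. \<Sum>i<N. \<bar>v j i\<bar>)" if "i < N" "j < p" for i j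
  proof -
    have "\<bar>v j i\<bar> \<le> (\<Sum>i<N. \<bar>v j i\<bar>)"
      using that by (intro member_le_sum[where f = "\<lambda>i. \<bar>v j i\<bar>"]) auto
    also have "\<dots> \<le> (\<Sum>j<p. \<Sum>i<N. \<bar>v j i\<bar>)"
      using that by (intro member_le_sum[where f = "\<lambda>j. \<Sum>i<N. \<bar>v j i\<bar>"]) (auto intro: sum_nonneg)
    finally show ?thesis .
  qed
  have nn: "0 \<le> (\<Sum>i<N. \<bar>y i\<bar>)" "0 \<le> (\<Sum>j<p. \<Sum>i<N. \<bar>v j i\<bar>)" by (auto intro!: sum_nonneg)
  obtain C where C: "C \<ge> 0" and taylor: "\<And>r w s. \<bar>r\<bar> \<le> B \<Longrightarrow> \<bar>w\<bar> \<le> B \<Longrightarrow> 0 \<le> s \<Longrightarrow> s \<le> 1 \<Longrightarrow>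
     \<bar>(r - s * w) ^ (2 * m) - r ^ (2 * m) + real (2 * m) * s * w * r ^ (2 * m - 1)\<bar> \<le> C * s\<^sup>2"
    using power_taylor_bound[of B "2 * m"] by blast
  define C' where "C' = 1 + real N * C"
  have C': "C' \<ge> 0" using C by (simp add: C'_def)
  show ?thesis
  proof (intro exI[of _ C'] conjI allI impI C')
    fix \<eta> :: real assume \<eta>: "0 < \<eta>" "\<eta> \<le> 1"
    obtain r where r: "r \<in> R" "\<Psi> r \<le> \<Delta> + \<eta>" using near \<eta> by blast
    then obtain a where a: "\<And>i. r i = y i - (\<Sum>j<p. a j * v j i)" unfolding R_def by blast
    have r_le: "\<bar>r i\<bar> \<le> Br" if "i < N" for i
    proof (cases "\<bar>r i\<bar> \<le> 1")
      case True
      then show ?thesis using \<Delta>0 by (simp add: Br_def)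
    next
      case False
      then have "\<bar>r i\<bar> \<le> \<bar>r i\<bar> ^ (2 * m)" using assms(1) by (intro self_le_power) auto
      also have "\<dots> = r i ^ (2 * m)" by (simp add: power_even_abs)
      also have "\<dots> \<le> \<Psi> r"
        unfolding \<Psi>_def using that by (intro member_le_sum[where f = "\<lambda>i. r i ^ (2 * m)"]) auto
      finally show ?thesis using r(2) \<eta> by (simp add: Br_def)
    qed
    have one_sided: "(\<Sum>i<N. r i ^ (2 * m - 1) * w i) \<le> C' * sqrt \<eta>"
      if w: "\<And>i. w i = (\<Sum>j<p. b j * v j i)" "\<And>i. i < N \<Longrightarrow> \<bar>w i\<bar> \<le> B" for w b
    proof -
      define s where "s = sqrt \<eta>"
      have s: "0 < s" "s \<le> 1" "s\<^sup>2 = \<eta>" using \<eta> by (auto simp: s_def)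
      define P where "P = (\<Sum>i<N. r i ^ (2 * m - 1) * w i)"
      have "(\<lambda>i. r i - s * w i) \<in> R" unfolding R_def mem_Collect_eq
        by (intro exI[of _ "\<lambda>j. a j + s * b j"])
          (simp add: a w(1) sum.distrib sum_distrib_left algebra_simps)
      then have "\<Delta> \<le> (\<Sum>i<N. (r i - s * w i) ^ (2 * m))" using low unfolding \<Psi>_def by blast
      also have "\<dots> \<le> (\<Sum>i<N. r i ^ (2 * m) - real (2 * m) * s * (r i ^ (2 * m - 1) * w i) + C * s\<^sup>2)"
      proof (rule sum_mono)
        fix i assume "i \<in> {..<N}"
        then have i: "i < N" by simp
        have "\<bar>r i\<bar> \<le> B" using r_le[OF i] nn unfolding B_def by linarith
        then show "(r i - s * w i) ^ (2 * m) \<le> r i ^ (2 * m) - real (2 * m) * s * (r i ^ (2 * m - 1) * w i) + C * s\<^sup>2"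
          using taylor[of "r i" "w i" s] w(2)[OF i] s by (simp add: algebra_simps abs_le_iff)
      qed
      also have "\<dots> = \<Psi> r - real (2 * m) * s * P + real N * C * s\<^sup>2"
        by (simp add: sum.distrib sum_subtractf \<Psi>_def P_def sum_distrib_left)
      finally have "s * (real (2 * m) * P) \<le> s * (C' * s)"
        using r(2) s(3) by (simp add: C'_def power2_eq_square algebra_simps)
      then have le: "real (2 * m) * P \<le> C' * s" using s by simp
      have "P \<le> C' * s"
      proof (cases "P \<le> 0")
        case True
        then show ?thesis using C' s by (smt (verit) mult_nonneg_nonneg)
      next
        case False
        then have "1 * P \<le> real (2 * m) * P" using assms(1) by (intro mult_right_mono) auto
        with le show ?thesis by simp
      qed
      then show ?thesis by (simp add: P_def s_def)
    qed
    have two_sided: "\<bar>\<Sum>i<N. r i ^ (2 * m - 1) * w i\<bar> \<le> C' * sqrt \<eta>"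
      if w: "\<And>i. w i = (\<Sum>j<p. b j * v j i)" "\<And>i. i < N \<Longrightarrow> \<bar>w i\<bar> \<le> B" for w b
      using one_sided[OF w] one_sided[of "\<lambda>i. - w i" "\<lambda>j. - b j"] w
      by (simp add: sum_negf abs_le_iff)
    show "\<exists>r\<in>R. \<Delta> \<le> (\<Sum>i<N. r i ^ (2 * m)) \<and> (\<Sum>i<N. r i ^ (2 * m)) \<le> \<Delta> + \<eta> \<and>
     (\<forall>j<p. \<bar>\<Sum>i<N. r i ^ (2 * m - 1) * v j i\<bar> \<le> C' * sqrt \<eta>) \<and>
     \<bar>\<Sum>i<N. r i ^ (2 * m - 1) * (y i - r i)\<bar> \<le> C' * sqrt \<eta>"
    proof (intro bexI[of _ r] conjI allI impI r(1))
      show "\<Delta> \<le> (\<Sum>i<N. r i ^ (2 * m))" "(\<Sum>i<N. r i ^ (2 * m)) \<le> \<Delta> + \<eta>"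
        using low[OF r(1)] r(2) by (auto simp: \<Psi>_def)
      show "\<bar>\<Sum>i<N. r i ^ (2 * m - 1) * (y i - r i)\<bar> \<le> C' * sqrt \<eta>"
      proof (rule two_sided)
        show "y i - r i = (\<Sum>j<p. a j * v j i)" for i by (simp add: a)
        show "\<bar>y i - r i\<bar> \<le> B" if "i < N" for i
          using y_le[OF that] r_le[OF that] nn unfolding B_def by linarith
      qed
      fix j assume j: "j < p"
      show "\<bar>\<Sum>i<N. r i ^ (2 * m - 1) * v j i\<bar> \<le> C' * sqrt \<eta>"
      proof (rule two_sided)
        have "(\<Sum>k<p. (if k = j then 1 else 0) * v k i) = (\<Sum>k<p. if k = j then v k i else 0)" for i
          by (intro sum.cong) auto
        then show "v j i = (\<Sum>k<p. (if k = j then 1 else 0) * v k i)" for i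
          using j by (simp add: sum.delta)
        show "\<bar>v j i\<bar> \<le> B" if "i < N" for i
          using v_le[OF that j] nn \<Delta>0 unfolding B_def Br_def by linarith
      qed
    qed
  qed
qed

text \<open>\<open>G\<close> is the Gram matrix of vectors \<open>w\<^sub>1, \<dots>, w\<^sub>N\<close> of norm at most \<open>\<rho>\<close>, and the hypothesis on \<open>y\<close> says
that \<open>y\<^sub>i\<close> is the inner product of \<open>w\<^sub>i\<close> with a vector of the unit ball, in a form that does
not mention the Hilbert space.

Let \<open>r\<close> be an almost optimal residual and \<open>\<phi> = r\<^sup>2\<^sup>m\<^sup>-\<^sup>1\<close>. Then \<open>\<Sum> r\<^sub>i\<^sup>2\<^sup>m\<close> is the pairing of \<open>\<phi>\<close> with \<open>y\<close>
up to a small error, so it is at most \<open>(\<phi>\<^sup>T G \<phi>)\<^sup>1\<^sup>/\<^sup>2\<close>. As \<open>\<phi>\<close> almost annihilates the chosen vectors, the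
random section bounds this by \<open>N \<delta> \<kappa>\<^sup>2\<^sup>m\<^sup>-\<^sup>1 / 2\<close>, where \<open>\<kappa>\<close> is the normalised norm of \<open>r\<close>. If \<open>\<kappa>\<close> were at
least \<open>\<delta>\<close>, this would be at most half of \<open>N \<kappa>\<^sup>2\<^sup>m\<close>, a contradiction.\<close>

lemma finite_kolmogorov_width:
  fixes G :: "nat \<Rightarrow> nat \<Rightarrow> real"
  assumes N: "1 \<le> N" and m: "1 \<le> m" and p: "1 \<le> p" and \<rho>: "0 < \<rho>"
    and sym: "\<And>i j. i < N \<Longrightarrow> j < N \<Longrightarrow> G i j = G j i"
    and psd: "\<And>\<phi>. 0 \<le> (\<Sum>i<N. \<Sum>j<N. \<phi> i * \<phi> j * G i j)"
    and diag: "\<And>i. i < N \<Longrightarrow> G i i \<le> \<rho>\<^sup>2"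
  defines "\<delta> \<equiv> 16 * sqrt (2 * real m / real p) * \<rho>"
  shows "\<exists>v :: nat \<Rightarrow> nat \<Rightarrow> real. \<forall>y.
     (\<forall>\<phi>. (\<Sum>i<N. \<phi> i * y i)\<^sup>2 \<le> (\<Sum>i<N. \<Sum>j<N. \<phi> i * \<phi> j * G i j)) \<longrightarrow>
     (\<exists>a. (\<Sum>i<N. (y i - (\<Sum>j<p. a j * v j i)) ^ (2 * m)) \<le> real N * \<delta> ^ (2 * m))"
proof -
  obtain W where W: "\<And>i j. i < N \<Longrightarrow> j < N \<Longrightarrow> G i j = (\<Sum>l<N. W i l * W j l)"
    using gram_factorization[OF sym psd] by blast
  have gram: "(\<Sum>i<N. \<Sum>j<N. \<phi> i * \<phi> j * G i j) = (\<Sum>l<N. (\<Sum>i<N. \<phi> i * W i l)\<^sup>2)" for \<phi>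
  proof -
    have "(\<Sum>i<N. \<Sum>j<N. \<phi> i * \<phi> j * G i j) = (\<Sum>i<N. \<Sum>j<N. \<Sum>l<N. (\<phi> i * W i l) * (\<phi> j * W j l))"
      by (intro sum.cong) (auto simp: W sum_distrib_left mult_ac)
    also have "\<dots> = (\<Sum>i<N. \<Sum>l<N. \<Sum>j<N. (\<phi> i * W i l) * (\<phi> j * W j l))"
      by (rule sum.cong[OF refl]) (rule sum.swap)
    also have "\<dots> = (\<Sum>l<N. \<Sum>i<N. \<Sum>j<N. (\<phi> i * W i l) * (\<phi> j * W j l))"
      by (rule sum.swap)
    finally show ?thesis by (simp add: power2_eq_square sum_product)
  qed
  have rows: "(\<Sum>l<N. (W i l)\<^sup>2) \<le> \<rho>\<^sup>2" if "i < N" for i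
    using diag[OF that] W[OF that that] by (simp add: power2_eq_square)
  define X where "X i \<omega> = (\<Sum>l<N. W i l * rad \<omega> l)" for i \<omega>
  define K where "K = 4 * real N * sqrt (2 * real m * real p) * \<rho>"
  obtain ws where len: "length ws = p" and low: "\<And>r. (\<Sum>i<N. r i ^ (2 * m)) \<le> real N \<Longrightarrow>
     real p * sqrt (\<Sum>l<N. (\<Sum>i<N. r i ^ (2 * m - 1) * W i l)\<^sup>2)
       \<le> 2 * ((\<Sum>\<omega>\<leftarrow>ws. \<bar>\<Sum>i<N. r i ^ (2 * m - 1) * X i \<omega>\<bar>) + K)"
    using low_Mstar_estimate[where W = W, OF N m p \<rho> rows] unfolding X_def K_def by blast
  define v where "v j i = X i (ws ! j)" for j i
  have \<delta>: "0 < \<delta>" using m p \<rho> by (simp add: \<delta>_def)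
  \<comment> \<open>the bound on the random section, extended to residuals of arbitrary size by homogeneity\<close>
  have dual_bound: "real p * sqrt (\<Sum>l<N. (\<Sum>i<N. r i ^ (2 * m - 1) * W i l)\<^sup>2)
       \<le> 2 * ((\<Sum>j<p. \<bar>\<Sum>i<N. r i ^ (2 * m - 1) * v j i\<bar>) + K * \<kappa> ^ (2 * m - 1))"
    if \<kappa>: "0 < \<kappa>" and r: "(\<Sum>i<N. r i ^ (2 * m)) \<le> real N * \<kappa> ^ (2 * m)" for r \<kappa>
  proof -
    define c where "c = \<kappa> ^ (2 * m - 1)"
    have c: "c > 0" using \<kappa> by (simp add: c_def)
    have "(\<Sum>i<N. (r i / \<kappa>) ^ (2 * m)) \<le> real N"
      using r \<kappa> by (simp add: power_divide sum_divide_distrib[symmetric] field_simps)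
    note low[OF this]
    moreover have "(\<Sum>i<N. (r i / \<kappa>) ^ (2 * m - 1) * z i) = (\<Sum>i<N. r i ^ (2 * m - 1) * z i) / c" for z
      by (simp add: power_divide c_def sum_divide_distrib)
    moreover have "sqrt (\<Sum>l<N. ((\<Sum>i<N. r i ^ (2 * m - 1) * W i l) / c)\<^sup>2)
       = sqrt (\<Sum>l<N. (\<Sum>i<N. r i ^ (2 * m - 1) * W i l)\<^sup>2) / c"
      using c by (simp add: power_divide sum_divide_distrib[symmetric] real_sqrt_divide)
    moreover have "(\<Sum>\<omega>\<leftarrow>ws. \<bar>(\<Sum>i<N. r i ^ (2 * m - 1) * X i \<omega>) / c\<bar>)
       = (\<Sum>j<p. \<bar>\<Sum>i<N. r i ^ (2 * m - 1) * v j i\<bar>) / c"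
    proof -
      have "(\<Sum>\<omega>\<leftarrow>ws. f \<omega> :: real) = (\<Sum>j<p. f (ws ! j))" for f
        by (simp add: sum_list_sum_nth len atLeast0LessThan)
      then show ?thesis using c by (simp add: v_def abs_divide sum_divide_distrib[symmetric])
    qed
    ultimately have "real p * (sqrt (\<Sum>l<N. (\<Sum>i<N. r i ^ (2 * m - 1) * W i l)\<^sup>2) / c)
       \<le> 2 * ((\<Sum>j<p. \<bar>\<Sum>i<N. r i ^ (2 * m - 1) * v j i\<bar>) / c + K)"
      by simp
    then show ?thesis unfolding c_def[symmetric] using c by (simp add: field_simps)
  qed
  show ?thesis
  proof (intro exI[of _ v] allI impI)
    fix y assume "\<forall>\<phi>. (\<Sum>i<N. \<phi> i * y i)\<^sup>2 \<le> (\<Sum>i<N. \<Sum>j<N. \<phi> i * \<phi> j * G i j)"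
    then have y: "(\<Sum>i<N. \<phi> i * y i) \<le> sqrt (\<Sum>l<N. (\<Sum>i<N. \<phi> i * W i l)\<^sup>2)" for \<phi>
      unfolding gram by (meson real_le_rsqrt)
    define R where "R = {r. \<exists>a. \<forall>i. r i = y i - (\<Sum>j<p. a j * v j i)}"
    define \<Delta> where "\<Delta> = Inf ((\<lambda>r. \<Sum>i<N. r i ^ (2 * m)) ` R)"
    obtain C where C: "C \<ge> 0" and near: "\<And>\<eta>. 0 < \<eta> \<Longrightarrow> \<eta> \<le> 1 \<Longrightarrow> (\<exists>r\<in>R.
      \<Delta> \<le> (\<Sum>i<N. r i ^ (2 * m)) \<and> (\<Sum>i<N. r i ^ (2 * m)) \<le> \<Delta> + \<eta> \<and>
      (\<forall>j<p. \<bar>\<Sum>i<N. r i ^ (2 * m - 1) * v j i\<bar> \<le> C * sqrt \<eta>) \<and>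
      \<bar>\<Sum>i<N. r i ^ (2 * m - 1) * (y i - r i)\<bar> \<le> C * sqrt \<eta>)"
      using almost_dual_functional[OF m, where y = y and v = v and p = p and N = N]
      unfolding R_def[symmetric] \<Delta>_def[symmetric] by blast
    show "\<exists>a. (\<Sum>i<N. (y i - (\<Sum>j<p. a j * v j i)) ^ (2 * m)) \<le> real N * \<delta> ^ (2 * m)"
    proof (rule ccontr)
      assume "\<not> ?thesis"
      then have far: "real N * \<delta> ^ (2 * m) < (\<Sum>i<N. (y i - (\<Sum>j<p. a j * v j i)) ^ (2 * m))" for a
        by (meson not_le)
      have "real N * \<delta> ^ (2 * m) \<le> \<Delta>"
        unfolding \<Delta>_def
      proof (rule cInf_greatest)
        have "y \<in> R" unfolding R_def mem_Collect_eq by (intro exI[of _ "\<lambda>_. 0"]) simp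
        then show "(\<lambda>r. \<Sum>i<N. r i ^ (2 * m)) ` R \<noteq> {}" by auto
        fix z assume "z \<in> (\<lambda>r. \<Sum>i<N. r i ^ (2 * m)) ` R"
        then obtain r a where "z = (\<Sum>i<N. r i ^ (2 * m))" "\<And>i. r i = y i - (\<Sum>j<p. a j * v j i)" unfolding R_def by blast
        with far[of a] show "real N * \<delta> ^ (2 * m) \<le> z" by simp
      qed
      moreover have "0 < real N * \<delta> ^ (2 * m)" using N \<delta> by simp
      ultimately have \<Delta>: "real N * \<delta> ^ (2 * m) \<le> \<Delta>" "0 < \<Delta>" by auto
      have main: "\<Delta> \<le> 6 * C * sqrt \<eta> + \<eta>" if \<eta>: "0 < \<eta>" "\<eta> \<le> 1" for \<eta>
      proof -
        obtain r where r: "\<Delta> \<le> (\<Sum>i<N. r i ^ (2 * m))" "(\<Sum>i<N. r i ^ (2 * m)) \<le> \<Delta> + \<eta>"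
          "\<And>j. j < p \<Longrightarrow> \<bar>\<Sum>i<N. r i ^ (2 * m - 1) * v j i\<bar> \<le> C * sqrt \<eta>"
          "\<bar>\<Sum>i<N. r i ^ (2 * m - 1) * (y i - r i)\<bar> \<le> C * sqrt \<eta>"
          using near[OF \<eta>] by blast
        define S where "S = sqrt (\<Sum>l<N. (\<Sum>i<N. r i ^ (2 * m - 1) * W i l)\<^sup>2)"
        define \<kappa> where "\<kappa> = root (2 * m) ((\<Delta> + \<eta>) / real N)"
        have \<kappa>: "0 < \<kappa>" "real N * \<kappa> ^ (2 * m) = \<Delta> + \<eta>"
          using m N \<Delta> \<eta> by (auto simp: \<kappa>_def)
        have "\<delta> = root (2 * m) (\<delta> ^ (2 * m))" using m \<delta> by (simp add: real_root_power_cancel)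
        also have "\<dots> \<le> \<kappa>"
          unfolding \<kappa>_def using m N \<Delta> \<eta> by (intro real_root_le_mono) (auto simp: field_simps)
        finally have \<delta>\<kappa>: "\<delta> \<le> \<kappa>" .
        have "\<delta> * \<kappa> ^ (2 * m - 1) \<le> \<kappa> * \<kappa> ^ (2 * m - 1)"
          using \<kappa> \<delta>\<kappa> by (intro mult_right_mono) auto
        also have "\<dots> = \<kappa> ^ (2 * m)"
          using power_minus_mult[of "2 * m" \<kappa>] m by (simp add: mult.commute)
        finally have N_le: "real N * (\<delta> * \<kappa> ^ (2 * m - 1)) \<le> \<Delta> + \<eta>"
          unfolding \<kappa>(2)[symmetric] by (intro mult_left_mono) auto
        have "4 * (K * \<kappa> ^ (2 * m - 1)) = real p * (real N * (\<delta> * \<kappa> ^ (2 * m - 1)))"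
        proof -
          have "real p * sqrt (2 * real m / real p) = sqrt (2 * real m * real p)"
            using p by (simp add: real_sqrt_divide real_sqrt_mult field_simps)
          then have "4 * K = real p * (real N * \<delta>)" by (simp add: K_def \<delta>_def algebra_simps)
          then show ?thesis by (simp add: mult.assoc[symmetric])
        qed
        also have "\<dots> \<le> real p * (\<Delta> + \<eta>)"
          by (intro mult_left_mono N_le) simp
        finally have K: "4 * (K * \<kappa> ^ (2 * m - 1)) \<le> real p * (\<Delta> + \<eta>)" .
        have "real p * S \<le> 2 * ((\<Sum>j<p. \<bar>\<Sum>i<N. r i ^ (2 * m - 1) * v j i\<bar>) + K * \<kappa> ^ (2 * m - 1))"
          unfolding S_def using r(2) by (intro dual_bound \<kappa>(1)) (simp add: \<kappa>(2))
        also have "\<dots> \<le> 2 * ((\<Sum>j<p. C * sqrt \<eta>) + K * \<kappa> ^ (2 * m - 1))"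
          using r(3) by (intro mult_left_mono add_right_mono sum_mono) auto
        also have "\<dots> \<le> real p * (2 * C * sqrt \<eta> + (\<Delta> + \<eta>) / 2)"
          using K by (simp add: algebra_simps)
        finally have S: "S \<le> 2 * C * sqrt \<eta> + (\<Delta> + \<eta>) / 2"
          using p by simp
        have "(\<Sum>i<N. r i ^ (2 * m)) = (\<Sum>i<N. r i ^ (2 * m - 1) * y i) - (\<Sum>i<N. r i ^ (2 * m - 1) * (y i - r i))"
        proof -
          have "r i ^ (2 * m) = r i ^ (2 * m - 1) * r i" for i
            using m by (intro power_minus_mult[symmetric]) simp
          then show ?thesis by (simp add: sum_subtractf[symmetric] right_diff_distrib)
        qed
        also have "\<dots> \<le> S + C * sqrt \<eta>"
          using y[of "\<lambda>i. r i ^ (2 * m - 1)"] r(4) by (simp add: S_def)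
        finally have "\<Delta> \<le> S + C * sqrt \<eta>" using r(1) by simp
        moreover define X where "X = C * sqrt \<eta>"
        ultimately have "\<Delta> \<le> S + X" "S \<le> 2 * X + (\<Delta> + \<eta>) / 2" using S by (auto simp: mult.assoc)
        then have "\<Delta> \<le> 6 * X + \<eta>" by (simp add: field_simps)
        then show ?thesis by (simp add: X_def mult.assoc)
      qed
      define s where "s = min 1 (\<Delta> / (2 * (6 * C + 1)))"
      have s: "0 < s" "s \<le> 1" using C \<Delta> by (auto simp: s_def)
      have "\<Delta> \<le> 6 * C * s + s * s"
        using main[of "s\<^sup>2"] s by (simp add: power2_eq_square mult_le_one)
      also have "\<dots> \<le> 6 * C * s + s * 1" using s by (intro add_left_mono mult_left_mono) auto
      also have "\<dots> = (6 * C + 1) * s" by (simp add: algebra_simps)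
      also have "\<dots> \<le> (6 * C + 1) * (\<Delta> / (2 * (6 * C + 1)))"
        using C by (intro mult_left_mono) (auto simp: s_def)
      also have "\<dots> = \<Delta> / 2" using C by (simp add: field_simps)
      finally show False using \<Delta> by simp
    qed
  qed
qed

section \<open>Integrals of the kernel\<close>

lemma integrable_mult_of_squares:
  fixes f g :: "'a \<Rightarrow> real"
  assumes "f \<in> borel_measurable M" "g \<in> borel_measurable M"
    and "integrable M (\<lambda>x. (f x)\<^sup>2)" "integrable M (\<lambda>x. (g x)\<^sup>2)"
  shows "integrable M (\<lambda>x. f x * g x)"
proof (rule Bochner_Integration.integrable_bound)
  show "integrable M (\<lambda>x. (f x)\<^sup>2 + (g x)\<^sup>2)" using assms by simp
  show "(\<lambda>x. f x * g x) \<in> borel_measurable M" using assms by simp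
  have "\<bar>a * b\<bar> \<le> a\<^sup>2 + b\<^sup>2" for a b :: real
    using sum_squares_bound[of "\<bar>a\<bar>" "\<bar>b\<bar>"] mult_nonneg_nonneg[of "\<bar>a\<bar>" "\<bar>b\<bar>"]
    unfolding abs_mult power2_abs by linarith
  then show "AE x in M. norm (f x * g x) \<le> norm ((f x)\<^sup>2 + (g x)\<^sup>2)"
    by simp
qed

lemma integrable_diff_square:
  fixes f g :: "'a \<Rightarrow> real"
  assumes "f \<in> borel_measurable M" "g \<in> borel_measurable M"
    and "integrable M (\<lambda>x. (f x)\<^sup>2)" "integrable M (\<lambda>x. (g x)\<^sup>2)"
  shows "integrable M (\<lambda>x. (f x - g x)\<^sup>2)"
  using assms integrable_mult_of_squares[OF assms] by (simp add: power2_diff mult.assoc)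

lemma Cauchy_Schwarz_integral:
  fixes f g :: "'a \<Rightarrow> real"
  assumes "f \<in> borel_measurable M" "g \<in> borel_measurable M"
    and "integrable M (\<lambda>x. (f x)\<^sup>2)" "integrable M (\<lambda>x. (g x)\<^sup>2)"
  shows "(LINT x|M. f x * g x)\<^sup>2 \<le> (LINT x|M. (f x)\<^sup>2) * (LINT x|M. (g x)\<^sup>2)"
proof -
  define a where "a = (LINT x|M. (f x)\<^sup>2)"
  define b where "b = (LINT x|M. f x * g x)"
  define c where "c = (LINT x|M. (g x)\<^sup>2)"
  note int = assms(3,4) integrable_mult_of_squares[OF assms]
  have quad: "0 \<le> a - 2 * t * b + t\<^sup>2 * c" for t
  proof -
    have "0 \<le> (LINT x|M. (f x - t * g x)\<^sup>2)" by simp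
    also have "(\<lambda>x. (f x - t * g x)\<^sup>2) = (\<lambda>x. (f x)\<^sup>2 - (2 * t) * (f x * g x) + t\<^sup>2 * (g x)\<^sup>2)"
      by (simp add: power2_diff power_mult_distrib fun_eq_iff mult_ac)
    also have "(LINT x|M. \<dots> x) = a - 2 * t * b + t\<^sup>2 * c"
      using int by (simp add: a_def b_def c_def)
    finally show ?thesis .
  qed
  have c: "0 \<le> c" by (simp add: c_def)
  have "b\<^sup>2 \<le> a * c"
  proof (cases "c = 0")
    case True
    have "b = 0"
    proof (rule ccontr)
      assume "b \<noteq> 0"
      then show False using quad[of "(a + 1) / (2 * b)"] True by simp
    qed
    then show ?thesis using True by simp
  next
    case False
    have "0 \<le> a - 2 * (b / c) * b + (b / c)\<^sup>2 * c" by (rule quad)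
    also have "\<dots> = a - b\<^sup>2 / c" using False by (simp add: power2_eq_square field_simps)
    finally show ?thesis using False c by (simp add: field_simps)
  qed
  then show ?thesis by (simp add: a_def b_def c_def)
qed

locale singular_kernel =
  fixes k :: "real \<Rightarrow> real"
  assumes nonneg: "\<And>x. x \<in> {0<..1} \<Longrightarrow> 0 \<le> k x"
    and cont: "continuous_on {0<..1} k"
    and decr: "strict_antimono_on {0<..1} k"
    and blowup: "filterlim k at_top (at_right 0)"
    and sq_int: "set_integrable lborel {0<..1} (\<lambda>u. (k u)\<^sup>2)"
begin

text \<open>Extended by 0, the kernel is monotone on the whole half-line, and translates can be integrated over
the real line without boundary terms.\<close>

definition ker :: "real \<Rightarrow> real" where
  "ker u = (if u \<in> {0<..1} then k u else 0)"

lemma ker_nonneg: "0 \<le> ker u"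
  using nonneg by (simp add: ker_def)

lemma ker_antimono: "0 < u \<Longrightarrow> u \<le> v \<Longrightarrow> ker v \<le> ker u"
  using decr nonneg[of u] unfolding ker_def monotone_on_def by (cases "u = v") (auto simp: less_imp_le)

lemma ker_measurable [measurable]: "ker \<in> borel_measurable borel"
proof -
  have "(\<lambda>u. indicator {0<..1} u *\<^sub>R k u) \<in> borel_measurable borel"
    using cont by (intro borel_measurable_continuous_on_indicator) auto
  moreover have "(\<lambda>u. indicator {0<..1} u *\<^sub>R k u) = ker"
    by (auto simp: ker_def indicator_def fun_eq_iff)
  ultimately show ?thesis by simp
qed

lemma ker_square: "(ker u)\<^sup>2 = indicator {0<..1} u * (k u)\<^sup>2"
  by (auto simp: ker_def indicator_def)

lemma ker_square_integrable: "integrable lborel (\<lambda>u. (ker u)\<^sup>2)"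
  using sq_int by (simp add: ker_square set_integrable_def)

definition energy :: "real \<Rightarrow> real" where
  "energy a = (LINT u|lborel. indicator {0<..a} u * (ker u)\<^sup>2)"

lemma energy_integrable: "integrable lborel (\<lambda>u. indicator A u * (ker u)\<^sup>2)" if "A \<in> sets borel" for A
  using that integrable_mult_indicator[OF _ ker_square_integrable, of A] by simp

lemma energy_mono: "a \<le> b \<Longrightarrow> energy a \<le> energy b"
  unfolding energy_def by (intro integral_mono energy_integrable) (auto simp: indicator_def)

lemma energy_nonneg: "0 \<le> energy a"
  unfolding energy_def by (intro integral_nonneg_AE) auto

lemma energy_eq: "energy a = (LINT u:{0<..a}|lborel. (k u)\<^sup>2)" if "a \<le> 1" for a
  unfolding energy_def set_lebesgue_integral_def
  using that by (intro Bochner_Integration.integral_cong) (auto simp: ker_def indicator_def)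

text \<open>The interval of length \<open>b\<close> starting at \<open>a\<close> contributes less than the one starting at 0.\<close>

lemma energy_add_le:
  assumes "0 \<le> a" "0 \<le> b"
  shows "energy (a + b) \<le> energy a + energy b"
proof -
  have "energy (a + b) = (LINT u|lborel. indicator {0<..a} u * (ker u)\<^sup>2 + indicator {a<..a + b} u * (ker u)\<^sup>2)"
    unfolding energy_def using assms by (intro Bochner_Integration.integral_cong) (auto simp: indicator_def)
  also have "\<dots> = energy a + (LINT u|lborel. indicator {a<..a + b} u * (ker u)\<^sup>2)"
    by (simp add: energy_def energy_integrable)
  also have "(LINT u|lborel. indicator {a<..a + b} u * (ker u)\<^sup>2)
     = (LINT u|lborel. indicator {0<..b} u * (ker (a + u))\<^sup>2)"
    using lborel_integral_real_affine[of 1 "\<lambda>u. indicator {a<..a + b} u * (ker u)\<^sup>2" a]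
    by (simp add: indicator_def cong: if_cong)
  also have "\<dots> \<le> energy b"
    unfolding energy_def
  proof (rule integral_mono)
    have "integrable lborel (\<lambda>u. indicator {a<..a + b} (a + 1 * u) * (ker (a + 1 * u))\<^sup>2)"
      by (intro lborel_integrable_real_affine energy_integrable) auto
    then show "integrable lborel (\<lambda>u. indicator {0<..b} u * (ker (a + u))\<^sup>2)"
      by (simp add: indicator_def cong: if_cong)
    show "indicator {0<..b} u * (ker (a + u))\<^sup>2 \<le> indicator {0<..b} u * (ker u)\<^sup>2" for u
      using assms ker_nonneg by (auto simp: indicator_def intro!: power_mono ker_antimono)
  qed (simp add: energy_integrable)
  finally show ?thesis by simp
qed

lemma energy_pos: assumes "0 < a" shows "0 < energy a"
proof -
  have "eventually (\<lambda>u. 1 \<le> k u) (at_right 0)"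
    using blowup by (simp add: filterlim_at_top)
  then obtain b where b: "0 < b" "\<And>u. 0 < u \<Longrightarrow> u < b \<Longrightarrow> 1 \<le> k u"
    unfolding eventually_at_right_field by auto
  define e where "e = min (min a 1) (b / 2)"
  have e: "0 < e" "e \<le> a" "e \<le> 1" "e < b" using assms b by (auto simp: e_def)
  have "e = (LINT u|lborel. indicator {0<..e} u)" using e by simp
  also have "\<dots> \<le> energy a"
    unfolding energy_def
  proof (intro integral_mono energy_integrable)
    fix u
    have "u \<in> {0<..e} \<Longrightarrow> 1 \<le> (ker u)\<^sup>2"
      using b(2)[of u] e by (simp add: ker_def one_le_power)
    then show "indicator {0<..e} u \<le> indicator {0<..a} u * (ker u)\<^sup>2"
      using e by (auto simp: indicator_def)
  qed (use e in auto)
  finally show ?thesis using e by simp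
qed

lemma energy_tendsto_0: "(\<lambda>N. energy (1 / real (Suc N))) \<longlonglongrightarrow> 0"
proof -
  have "(\<lambda>N. LINT u|lborel. indicator {0<..1 / real (Suc N)} u * (ker u)\<^sup>2) \<longlonglongrightarrow> integral\<^sup>L (lborel :: real measure) (\<lambda>_. 0 :: real)"
  proof (rule integral_dominated_convergence[where w = "\<lambda>u. (ker u)\<^sup>2"
        and s = "\<lambda>N u. indicator {0<..1 / real (Suc N)} u * (ker u)\<^sup>2" and f = "\<lambda>_. 0" and M = lborel])
    show "AE u in lborel. (\<lambda>N. indicator {0<..1 / real (Suc N)} u * (ker u)\<^sup>2) \<longlonglongrightarrow> 0"
    proof (intro always_eventually allI)
      fix u :: real
      have "eventually (\<lambda>N. indicator {0<..1 / real (Suc N)} u * (ker u)\<^sup>2 = 0) sequentially"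
      proof (cases "0 < u")
        case True
        have "eventually (\<lambda>N. 1 / real (Suc N) < u) sequentially"
          using LIMSEQ_inverse_real_of_nat True by (simp add: order_tendstoD(2) inverse_eq_divide)
        then show ?thesis by eventually_elim (auto simp: indicator_def)
      qed (auto simp: indicator_def)
      then show "(\<lambda>N. indicator {0<..1 / real (Suc N)} u * (ker u)\<^sup>2) \<longlonglongrightarrow> 0"
        by (rule tendsto_eventually)
    qed
    show "AE u in lborel. norm (indicator {0<..1 / real (Suc N)} u * (ker u)\<^sup>2) \<le> (ker u)\<^sup>2" for N
      by (auto simp: indicator_def)
  qed (auto simp: ker_square_integrable)
  then show ?thesis by (simp add: energy_def)
qed

definition even_ker_square :: "real \<Rightarrow> real" where "even_ker_square x = (ker \<bar>x\<bar>)\<^sup>2"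

lemma even_ker_square_integrable: "integrable lborel even_ker_square"
proof -
  have "integrable lborel (\<lambda>x. (ker (0 + (-1) * x))\<^sup>2)"
    by (rule lborel_integrable_real_affine[OF ker_square_integrable]) simp
  then have "integrable lborel (\<lambda>x. (ker x)\<^sup>2 + (ker (- x))\<^sup>2)"
    using ker_square_integrable by simp
  moreover have "(\<lambda>x. (ker x)\<^sup>2 + (ker (- x))\<^sup>2) = even_ker_square"
    by (auto simp: even_ker_square_def ker_def fun_eq_iff)
  ultimately show ?thesis by simp
qed

lemma even_ker_square_interval:
  assumes "0 \<le> h"
  shows "(LINT x|lborel. indicator {- h..h} x * even_ker_square x) = 2 * energy h"
proof -
  have "(LINT x|lborel. indicator {- h..h} x * even_ker_square x)
      = (LINT x|lborel. indicator {0<..h} x * (ker x)\<^sup>2 + indicator {0<..h} (- x) * (ker (- x))\<^sup>2)"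
    using assms by (intro Bochner_Integration.integral_cong) (auto simp: even_ker_square_def ker_def indicator_def)
  also have "\<dots> = energy h + (LINT x|lborel. indicator {0<..h} (- x) * (ker (- x))\<^sup>2)"
  proof (subst Bochner_Integration.integral_add)
    have "integrable lborel (\<lambda>x. indicator {0<..h} (0 + (-1) * x) * (ker (0 + (-1) * x))\<^sup>2)"
      by (intro lborel_integrable_real_affine energy_integrable) auto
    then show "integrable lborel (\<lambda>x. indicator {0<..h} (- x) * (ker (- x))\<^sup>2)" by simp
  qed (auto simp: energy_integrable energy_def)
  also have "(LINT x|lborel. indicator {0<..h} (- x) * (ker (- x))\<^sup>2) = energy h"
    using lborel_integral_real_affine[of "-1" "\<lambda>u. indicator {0<..h} u * (ker u)\<^sup>2" 0]
    by (simp add: energy_def)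
  finally show ?thesis by simp
qed

lemma even_ker_square_antimono: "0 < \<bar>x\<bar> \<Longrightarrow> \<bar>x\<bar> \<le> \<bar>y\<bar> \<Longrightarrow> even_ker_square y \<le> even_ker_square x"
  unfolding even_ker_square_def using ker_nonneg by (intro power_mono ker_antimono) auto

text \<open>For \<open>x > 0\<close> the point \<open>x - h\<close> is no farther from the origin than \<open>x + h\<close>, so that there
\<open>\<bar>g (x + h) - g (x - h)\<bar> = g (x - h) - g (x + h)\<close> for the even unimodal function \<open>g\<close>. Integrated over the
half-line, this is the integral of \<open>g\<close> over \<open>[-h, h]\<close>. The other half-line contributes the same
amount.\<close>

lemma even_ker_square_shift:
  assumes "0 \<le> h"
  shows "(LINT x|lborel. \<bar>even_ker_square (x + h) - even_ker_square (x - h)\<bar>) \<le> 4 * energy h"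
    and "integrable lborel (\<lambda>x. \<bar>even_ker_square (x + h) - even_ker_square (x - h)\<bar>)"
proof -
  have shift: "integrable lborel (\<lambda>x. indicator A (x + c) * even_ker_square (x + c))"
    "(LINT x|lborel. indicator A (x + c) * even_ker_square (x + c)) = (LINT x|lborel. indicator A x * even_ker_square x)"
    if A: "A \<in> sets borel" for c A
  proof -
    have i: "integrable lborel (\<lambda>x. indicator A x * even_ker_square x)"
      using A integrable_mult_indicator[OF _ even_ker_square_integrable, of A] by simp
    from lborel_integrable_real_affine[OF this, of 1 c]
    show "integrable lborel (\<lambda>x. indicator A (x + c) * even_ker_square (x + c))" by (simp add: add.commute)
    show "(LINT x|lborel. indicator A (x + c) * even_ker_square (x + c)) = (LINT x|lborel. indicator A x * even_ker_square x)"
      using lborel_integral_real_affine[of 1 "\<lambda>x. indicator A x * even_ker_square x" c] by (simp add: add.commute)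
  qed
  have int: "integrable lborel (\<lambda>x. even_ker_square (x + c))" for c
    using shift(1)[of UNIV c] by simp
  from int[of h] int[of "- h"] show "integrable lborel (\<lambda>x. \<bar>even_ker_square (x + h) - even_ker_square (x - h)\<bar>)"
    by (intro integrable_abs Bochner_Integration.integrable_diff) auto
  let ?R = "\<lambda>c x. indicator {c..} x * even_ker_square x" and ?L = "\<lambda>c x. indicator {..c} x * even_ker_square x"
  have R: "integrable lborel (?R c)" for c using shift(1)[of "{c..}" 0] by simp
  have L: "integrable lborel (?L c)" for c using shift(1)[of "{..c}" 0] by simp
  have Ii: "integrable lborel (\<lambda>x. indicator {- h..h} x * even_ker_square x)" using shift(1)[of "{- h..h}" 0] by simp
  \<comment> \<open>monotonicity fails at the origin, where the extended kernel vanishes, so \<open>x = h\<close> and \<open>x = - h\<close> are excluded\<close>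
  have "(LINT x|lborel. \<bar>even_ker_square (x + h) - even_ker_square (x - h)\<bar>)
     \<le> (LINT x|lborel. (?R (- h) (x - h) - ?R h (x + h)) + (?L h (x + h) - ?L (- h) (x - h)))"
  proof (rule integral_mono_AE)
    show "AE x in lborel. \<bar>even_ker_square (x + h) - even_ker_square (x - h)\<bar>
        \<le> (?R (- h) (x - h) - ?R h (x + h)) + (?L h (x + h) - ?L (- h) (x - h))"
      using AE_lborel_singleton[of h] AE_lborel_singleton[of "- h"]
    proof eventually_elim
      case (elim x)
      show ?case
      proof (cases "x = 0")
        case True
        then show ?thesis using assms ker_nonneg by (simp add: even_ker_square_def)
      next
        case False
        then consider "0 < x" | "x < 0" by linarith
        then show ?thesis
        proof cases
          case 1
          then have "even_ker_square (x + h) \<le> even_ker_square (x - h)"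
            using elim assms by (intro even_ker_square_antimono) auto
          then show ?thesis using 1 by simp
        next
          case 2
          then have "even_ker_square (x - h) \<le> even_ker_square (x + h)"
            using elim assms by (intro even_ker_square_antimono) auto
          then show ?thesis using 2 by simp
        qed
      qed
    qed
  next
    show "integrable lborel (\<lambda>x. (?R (- h) (x - h) - ?R h (x + h)) + (?L h (x + h) - ?L (- h) (x - h)))"
      using shift(1)[of "{- h..}" "- h"] shift(1)[of "{h..}" h] shift(1)[of "{..h}" h] shift(1)[of "{..- h}" "- h"]
      by (intro Bochner_Integration.integrable_add Bochner_Integration.integrable_diff) auto
  qed fact
  also have "\<dots> = ((LINT x|lborel. ?R (- h) x) - (LINT x|lborel. ?R h x))
       + ((LINT x|lborel. ?L h x) - (LINT x|lborel. ?L (- h) x))"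
    using shift[of "{- h..}" "- h"] shift[of "{h..}" h] shift[of "{..h}" h] shift[of "{..- h}" "- h"]
    by simp
  also have "\<dots> = (LINT x|lborel. (?R (- h) x - ?R h x) + (?L h x - ?L (- h) x))"
    using R L by simp
  also have "\<dots> = (LINT x|lborel. 2 * (indicator {- h..h} x * even_ker_square x))"
  proof (rule integral_cong_AE)
    show "AE x in lborel. (?R (- h) x - ?R h x) + (?L h x - ?L (- h) x) = 2 * (indicator {- h..h} x * even_ker_square x)"
      using AE_lborel_singleton[of h] AE_lborel_singleton[of "- h"]
      by eventually_elim (use assms in \<open>auto simp: indicator_def\<close>)
  qed (use R L Ii in \<open>auto intro!: borel_measurable_integrable\<close>)
  also have "\<dots> = 4 * energy h"
    using even_ker_square_interval[OF assms] by simp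
  finally show "(LINT x|lborel. \<bar>even_ker_square (x + h) - even_ker_square (x - h)\<bar>) \<le> 4 * energy h" .
qed

end

section \<open>Function classes, step functions and Kolmogorov numbers\<close>

lemma AE_unit: "(AE x in lborel. x \<in> {0..1} \<longrightarrow> P x) \<Longrightarrow> AE x in unit_lborel. P x" for P :: "real \<Rightarrow> bool"
  by (subst AE_restrict_space_iff) auto

lemma space_unit [simp]: "space unit_lborel = {0..1}"
  by (simp add: space_restrict_space)

lemma measurable_unit: "f \<in> borel_measurable borel \<Longrightarrow> f \<in> borel_measurable unit_lborel"
  by (intro measurable_restrict_space1) simp

lemma integrable_unit:
  fixes f :: "real \<Rightarrow> real"
  shows "integrable lborel f \<Longrightarrow> integrable unit_lborel f"
  using integrable_mult_indicator[of "{0..1}" lborel f] by (subst integrable_restrict_space) auto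

lemma integral_unit:
  fixes f :: "real \<Rightarrow> real"
  shows "(LINT x|unit_lborel. f x) = (LINT x|lborel. indicator {0..1} x * f x)"
  by (subst integral_restrict_space) auto

lemma integral_unit_le:
  fixes f :: "real \<Rightarrow> real"
  assumes "integrable lborel f" "\<And>x. 0 \<le> f x"
  shows "(LINT x|unit_lborel. f x) \<le> (LINT x|lborel. f x)"
  unfolding integral_unit using assms integrable_mult_indicator[OF _ assms(1), of "{0..1}"]
  by (intro integral_mono) (auto simp: indicator_def)

lemma integrable_unit_const [simp]: "integrable unit_lborel (\<lambda>_. c::real)"
  by (subst integrable_restrict_space) auto

lemma measure_unit [simp]: "measure unit_lborel {0..1} = 1"
  by (simp add: measure_restrict_space)

lemma integrable_unit_bounded:
  fixes f :: "real \<Rightarrow> real"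
  assumes "f \<in> borel_measurable unit_lborel" "\<And>x. x \<in> {0..1} \<Longrightarrow> \<bar>f x\<bar> \<le> M"
  shows "integrable unit_lborel f"
  by (rule Bochner_Integration.integrable_bound[OF integrable_unit_const[of M]])
    (use assms in \<open>auto intro!: AE_I2 intro: order_trans[OF _ abs_ge_self]\<close>)

lemma ae_fun_cases:
  obtains f where "f \<in> borel_measurable unit_lborel" "x = abs_ae_fun f"
proof
  show "rep_ae_fun x \<in> borel_measurable unit_lborel"
    using Quotient3_rep_reflp[OF Quotient3_ae_fun, of x] by (simp add: ae_rel_def)
  show "x = abs_ae_fun (rep_ae_fun x)"
    by (simp add: Quotient3_abs_rep[OF Quotient3_ae_fun])
qed

lemma abs_plus:
  assumes "f \<in> borel_measurable unit_lborel" "g \<in> borel_measurable unit_lborel"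
  shows "abs_ae_fun f + abs_ae_fun g = abs_ae_fun (\<lambda>x. f x + g x)"
  using assms by (intro plus_ae_fun.abs_eq) (auto simp: ae_rel_def)

lemma abs_minus:
  assumes "f \<in> borel_measurable unit_lborel" "g \<in> borel_measurable unit_lborel"
  shows "abs_ae_fun f - abs_ae_fun g = abs_ae_fun (\<lambda>x. f x - g x)"
  using assms by (intro minus_ae_fun.abs_eq) (auto simp: ae_rel_def)

context
  fixes f :: "real \<Rightarrow> real"
  assumes f: "f \<in> borel_measurable unit_lborel"
begin

lemma abs_scale: "c *\<^sub>R abs_ae_fun f = abs_ae_fun (\<lambda>x. c * f x)"
  using f by (intro scaleR_ae_fun.abs_eq) (auto simp: ae_rel_def)

lemma abs_in_Lp: "abs_ae_fun f \<in> Lp p \<longleftrightarrow> integrable unit_lborel (\<lambda>x. \<bar>f x\<bar> powr p)"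
  unfolding Lp_def mem_Collect_eq using f by (intro in_Lp.abs_eq) (auto simp: ae_rel_def)

lemma abs_Lp_norm: "Lp_norm p (abs_ae_fun f) = (LINT x|unit_lborel. \<bar>f x\<bar> powr p) powr (1 / p)"
  using f by (intro Lp_norm.abs_eq) (auto simp: ae_rel_def)

end

lemma abs_powr_2: "\<bar>a\<bar> powr 2 = a\<^sup>2" for a :: real
  by (cases "a = 0") auto

lemma abs_in_L2:
  "f \<in> borel_measurable unit_lborel \<Longrightarrow> abs_ae_fun f \<in> Lp 2 \<longleftrightarrow> integrable unit_lborel (\<lambda>x. (f x)\<^sup>2)"
  by (simp add: abs_in_Lp abs_powr_2)

lemma abs_L2_norm:
  "f \<in> borel_measurable unit_lborel \<Longrightarrow> Lp_norm 2 (abs_ae_fun f) = sqrt (LINT x|unit_lborel. (f x)\<^sup>2)"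
  by (simp add: abs_Lp_norm abs_powr_2 powr_half_sqrt)

lemma Lp_norm_nonneg: "0 \<le> Lp_norm p x"
  by (cases x rule: ae_fun_cases) (simp add: abs_Lp_norm)

lemma zero_ae_fun_abs: "0 = abs_ae_fun (\<lambda>_. 0)"
  unfolding zero_ae_fun_def ..

lemma Lp_bounded:
  assumes f: "f \<in> borel_measurable unit_lborel" and M: "\<And>x. x \<in> {0..1} \<Longrightarrow> \<bar>f x\<bar> \<le> M" and q: "1 \<le> q"
  shows "abs_ae_fun f \<in> Lp q" and "Lp_norm q (abs_ae_fun f) \<le> M"
proof -
  have M0: "0 \<le> M" using M[of 0] by simp
  have le: "\<bar>f x\<bar> powr q \<le> M powr q" if "x \<in> {0..1}" for x
    using M[OF that] q by (intro powr_mono2) auto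
  have int: "integrable unit_lborel (\<lambda>x. \<bar>f x\<bar> powr q)"
    using f le by (intro integrable_unit_bounded[where M = "M powr q"]) auto
  then show "abs_ae_fun f \<in> Lp q" using f by (simp add: abs_in_Lp)
  have "(LINT x|unit_lborel. \<bar>f x\<bar> powr q) \<le> (LINT x|unit_lborel. M powr q)"
    using int le by (intro integral_mono) auto
  then have "(LINT x|unit_lborel. \<bar>f x\<bar> powr q) powr (1 / q) \<le> (M powr q) powr (1 / q)"
    using q by (intro powr_mono2) auto
  also have "\<dots> = M" using q M0 by (simp add: powr_powr)
  finally show "Lp_norm q (abs_ae_fun f) \<le> M" using f by (simp add: abs_Lp_norm)
qed

text \<open>The pointwise bound \<open>\<bar>b\<bar>\<^sup>q \<le> 1 + b\<^sup>2\<^sup>m\<close> replaces the comparison of norms by Jensen's inequality and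
costs only the factor 2.\<close>

lemma Lp_norm_le_even_moment:
  assumes f: "f \<in> borel_measurable unit_lborel" and int: "integrable unit_lborel (\<lambda>x. f x ^ (2 * m))"
    and A: "0 < A" "(LINT x|unit_lborel. f x ^ (2 * m)) \<le> A ^ (2 * m)" and q: "1 \<le> q" "q \<le> 2 * real m"
  shows "Lp_norm q (abs_ae_fun f) \<le> 2 * A"
proof -
  have le: "\<bar>a\<bar> powr q \<le> A powr q * (1 + a ^ (2 * m) / A ^ (2 * m))" for a
  proof -
    define b where "b = \<bar>a\<bar> / A"
    have b: "0 \<le> b" using A by (simp add: b_def)
    have "b powr q \<le> 1 + b ^ (2 * m)"
    proof (cases "b \<le> 1")
      case True
      then have "b powr q \<le> 1" using b q by (intro powr_le1) auto
      then show ?thesis using b by (smt (verit) zero_le_power)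
    next
      case False
      then have "b powr q \<le> b powr (real (2 * m))" using q by (intro powr_mono) auto
      also have "\<dots> = b ^ (2 * m)" using False by (subst powr_realpow) auto
      finally show ?thesis by simp
    qed
    then have "A powr q * b powr q \<le> A powr q * (1 + b ^ (2 * m))" by (intro mult_left_mono) auto
    moreover have "A powr q * b powr q = \<bar>a\<bar> powr q"
      using A by (simp add: b_def powr_divide)
    moreover have "b ^ (2 * m) = a ^ (2 * m) / A ^ (2 * m)"
      by (simp add: b_def power_divide power_even_abs)
    ultimately show ?thesis by simp
  qed
  have "(LINT x|unit_lborel. \<bar>f x\<bar> powr q) \<le> (LINT x|unit_lborel. A powr q * (1 + f x ^ (2 * m) / A ^ (2 * m)))"
  proof (rule integral_mono)
    show *: "integrable unit_lborel (\<lambda>x. A powr q * (1 + f x ^ (2 * m) / A ^ (2 * m)))"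
      using int by (intro integrable_mult_right Bochner_Integration.integrable_add) auto
    show "integrable unit_lborel (\<lambda>x. \<bar>f x\<bar> powr q)"
    proof (rule Bochner_Integration.integrable_bound[OF *])
      show "AE x in unit_lborel. norm (\<bar>f x\<bar> powr q) \<le> norm (A powr q * (1 + f x ^ (2 * m) / A ^ (2 * m)))"
        using le by (intro always_eventually allI) (simp only: real_norm_def abs_of_nonneg[OF powr_ge_zero],
          rule order_trans[OF _ abs_ge_self])
    qed (use f in auto)
  qed (rule le)
  also have "\<dots> = A powr q * (1 + (LINT x|unit_lborel. f x ^ (2 * m)) / A ^ (2 * m))"
    using int by simp
  also have "\<dots> \<le> A powr q * (1 + 1)"
    using A by (intro mult_left_mono add_left_mono) auto
  finally have "(LINT x|unit_lborel. \<bar>f x\<bar> powr q) powr (1 / q) \<le> (A powr q * 2) powr (1 / q)"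
    using q by (intro powr_mono2) auto
  also have "\<dots> = A * 2 powr (1 / q)" using A q by (simp add: powr_mult powr_powr)
  also have "\<dots> \<le> A * 2 powr 1" using A q by (intro mult_left_mono powr_mono) auto
  finally show ?thesis using f by (simp add: abs_Lp_norm)
qed

text \<open>The point \<open>t\<close> lies in \<open>[i / N, (i + 1) / N)\<close> where \<open>i = cell N t\<close>. The endpoint \<open>t = 1\<close> has the extra index
\<open>N\<close>, which is why statements about cells exclude it, at the cost of a null set.\<close>

definition cell :: "nat \<Rightarrow> real \<Rightarrow> nat" where
  "cell N t = nat \<lfloor>real N * t\<rfloor>"

lemma cell_bounds:
  assumes "0 \<le> t" "t < 1" "1 \<le> N"
  shows "cell N t < N" "real (cell N t) / real N \<le> t" "t - real (cell N t) / real N \<le> 1 / real N"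
proof -
  have c: "real (cell N t) = of_int \<lfloor>real N * t\<rfloor>" using assms by (simp add: cell_def)
  have "real N * t < real N" using assms by simp
  then have "real (cell N t) < real N" unfolding c by linarith
  then show "cell N t < N" by simp
  have "real (cell N t) \<le> real N * t" "real N * t \<le> real (cell N t) + 1" unfolding c by linarith+
  then have "real (cell N t) / real N \<le> t" "t \<le> (real (cell N t) + 1) / real N"
    using assms by (auto simp: field_simps)
  then show "real (cell N t) / real N \<le> t" "t - real (cell N t) / real N \<le> 1 / real N"
    by (auto simp: add_divide_distrib)
qed

lemma cell_measurable [measurable]: "cell N \<in> borel \<rightarrow>\<^sub>M count_space UNIV"
  unfolding cell_def[abs_def] by measurable

lemma step_measurable: "(\<lambda>t. c (cell N t) :: real) \<in> borel_measurable borel"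
  by measurable

lemma integral_step:
  assumes N: "1 \<le> N"
  shows "(LINT t|unit_lborel. c (cell N t)) = (\<Sum>i<N. c i) / real N" (is ?int)
    and "integrable unit_lborel (\<lambda>t. c (cell N t))"
proof -
  have eq: "indicator {0..1} t * c (cell N t) = (\<Sum>i<N. indicator {real i / real N..<(real i + 1) / real N} t * c i)"
    if "t \<noteq> 1" for t
  proof (cases "t \<in> {0..<1}")
    case True
    have "t \<in> {real i / real N..<(real i + 1) / real N} \<longleftrightarrow> i = cell N t" for i
    proof -
      have "t \<in> {real i / real N..<(real i + 1) / real N} \<longleftrightarrow> real i \<le> real N * t \<and> real N * t < real i + 1"
        using N by (auto simp: field_simps)
      also have "\<dots> \<longleftrightarrow> \<lfloor>real N * t\<rfloor> = int i" by (auto simp: floor_eq_iff)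
      also have "\<dots> \<longleftrightarrow> i = cell N t" using True by (auto simp: cell_def)
      finally show ?thesis .
    qed
    then have "(\<Sum>i<N. indicator {real i / real N..<(real i + 1) / real N} t * c i) = (\<Sum>i<N. if i = cell N t then c i else 0)"
      by (intro sum.cong) (auto simp: indicator_def)
    then show ?thesis using True cell_bounds(1)[of t N] N by (simp add: sum.delta)
  next
    case False
    have "t \<notin> {real i / real N..<(real i + 1) / real N}" if "i < N" for i
    proof
      assume t: "t \<in> {real i / real N..<(real i + 1) / real N}"
      have "0 \<le> real i / real N" "(real i + 1) / real N \<le> 1" using that by (auto simp: field_simps)
      with t False show False by auto
    qed
    then have "(\<Sum>i<N. indicator {real i / real N..<(real i + 1) / real N} t * c i) = 0"
      by (intro sum.neutral) (auto simp: indicator_def)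
    moreover have "t \<notin> {0..1}" using False \<open>t \<noteq> 1\<close> by auto
    ultimately show ?thesis by simp
  qed
  have ind: "integrable lborel (indicator {real i / real N..<(real i + 1) / real N} :: real \<Rightarrow> real)" for i
    by (intro integrable_real_indicator) (auto simp: divide_right_mono)
  have int: "integrable lborel (\<lambda>t. \<Sum>i<N. indicator {real i / real N..<(real i + 1) / real N} t * c i)"
    by (intro Bochner_Integration.integrable_sum integrable_mult_left ind)
  have ae: "AE t in lborel. indicator {0..1} t * c (cell N t) = (\<Sum>i<N. indicator {real i / real N..<(real i + 1) / real N} t * c i)"
    using AE_lborel_singleton[of "1::real"] by eventually_elim (rule eq)
  have m: "(\<lambda>t. indicator {0..1} t * c (cell N t)) \<in> borel_measurable lborel" by measurable
  have "integrable lborel (\<lambda>t. indicator {0..1} t * c (cell N t))"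
    using int by (subst integrable_cong_AE[OF m _ ae]) auto
  then show "integrable unit_lborel (\<lambda>t. c (cell N t))"
    by (subst integrable_restrict_space) auto
  have "(LINT t|unit_lborel. c (cell N t)) = (LINT t|lborel. (\<Sum>i<N. indicator {real i / real N..<(real i + 1) / real N} t * c i))"
    unfolding integral_unit using ae int by (intro integral_cong_AE m) auto
  also have "\<dots> = (\<Sum>i<N. (LINT t|lborel. indicator {real i / real N..<(real i + 1) / real N} t) * c i)"
    using ind by (subst Bochner_Integration.integral_sum) auto
  also have "\<dots> = (\<Sum>i<N. c i / real N)"
    by (intro sum.cong) (auto simp: divide_right_mono diff_divide_distrib[symmetric])
  finally show ?int by (simp add: sum_divide_distrib)
qed

definition step_fun :: "nat \<Rightarrow> (nat \<Rightarrow> real) \<Rightarrow> ae_fun" where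
  "step_fun N c = abs_ae_fun (\<lambda>t. c (cell N t))"

lemma step_fun_meas: "(\<lambda>t. c (cell N t) :: real) \<in> borel_measurable unit_lborel"
  by (intro measurable_unit step_measurable)

lemma subspace_step_fun: "subspace (range (step_fun N))"
proof (rule subspaceI)
  show "0 \<in> range (step_fun N)" by (auto simp: step_fun_def zero_ae_fun_abs intro!: image_eqI[of _ _ "\<lambda>_. 0"])
next
  fix x y assume "x \<in> range (step_fun N)" "y \<in> range (step_fun N)"
  then obtain b c where "x = step_fun N b" "y = step_fun N c" by auto
  then have "x + y = step_fun N (\<lambda>i. b i + c i)"
    by (simp add: step_fun_def abs_plus step_fun_meas)
  then show "x + y \<in> range (step_fun N)" by simp
next
  fix r x assume "x \<in> range (step_fun N)"
  then obtain c where "x = step_fun N c" by auto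
  then have "r *\<^sub>R x = step_fun N (\<lambda>i. r * c i)"
    by (simp add: step_fun_def abs_scale[OF step_fun_meas])
  then show "r *\<^sub>R x \<in> range (step_fun N)" by simp
qed

lemma step_fun_sum: "(\<Sum>j\<in>J. b j *\<^sub>R step_fun N (v j)) = step_fun N (\<lambda>i. \<Sum>j\<in>J. b j * v j i)"
proof (induction J rule: infinite_finite_induct)
  case (insert j J)
  then show ?case
    by (simp add: step_fun_def abs_plus abs_scale[OF step_fun_meas] step_fun_meas
        measurable_unit)
qed (auto simp: step_fun_def zero_ae_fun_abs)

lemma step_fun_in_Lp:
  assumes "1 \<le> q"
  shows "step_fun N c \<in> Lp q"
proof -
  have "\<bar>c (cell N t)\<bar> \<le> (\<Sum>i\<le>N. \<bar>c i\<bar>)" if "t \<in> {0..1}" for t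
  proof -
    have "real N * t \<le> real N" using that by (simp add: mult_left_le)
    then have "cell N t \<le> N" unfolding cell_def by (simp add: nat_le_iff floor_le_iff)
    then show ?thesis by (intro member_le_sum[where f = "\<lambda>i. \<bar>c i\<bar>"]) auto
  qed
  then show ?thesis unfolding step_fun_def by (intro Lp_bounded(1)[OF step_fun_meas _ assms])
qed

text \<open>Boundedness of \<open>T\<close> on the unit ball ensures that the infima and suprema of real numbers in the
definition are genuine bounds.\<close>

lemma kolmogorov_number_le:
  assumes NY: "\<And>y. 0 \<le> NY y" and x0: "x0 \<in> X" "NX x0 \<le> 1"
    and bound: "\<And>x. x \<in> X \<Longrightarrow> NX x \<le> 1 \<Longrightarrow> NY (T x) \<le> M"
    and F: "subspace F" "F \<subseteq> Y" "finite B" "F \<subseteq> span B" "dim F < n"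
    and approx: "\<And>x. x \<in> X \<Longrightarrow> NX x \<le> 1 \<Longrightarrow> \<exists>z\<in>F. NY (T x - z) \<le> D"
  shows "kolmogorov_number X NX Y NY n T \<le> D"
proof -
  have bdd: "bdd_below ((\<lambda>z. NY (y - z)) ` F')" for y F'
    using NY by (intro bdd_belowI2[where m = 0])
  have nonneg: "0 \<le> operator_norm X NX (quotient_norm NY F') T" if F': "subspace F'" for F'
    unfolding operator_norm_def
  proof (rule cSUP_upper2)
    show "bdd_above ((\<lambda>x. quotient_norm NY F' (T x)) ` {x \<in> X. NX x \<le> 1})"
    proof (rule bdd_aboveI2)
      fix x assume "x \<in> {x \<in> X. NX x \<le> 1}"
      then show "quotient_norm NY F' (T x) \<le> M"
        unfolding quotient_norm_def using subspace_0[OF F'] bound[of x]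
        by (intro cINF_lower2[OF bdd]) auto
    qed
    show "0 \<le> quotient_norm NY F' (T x0)"
      unfolding quotient_norm_def using NY subspace_0[OF F'] by (intro cINF_greatest) auto
  qed (use x0 in auto)
  have "kolmogorov_number X NX Y NY n T \<le> operator_norm X NX (quotient_norm NY F) T"
    unfolding kolmogorov_number_def
    using F nonneg by (intro cINF_lower bdd_belowI2[where m = 0]) auto
  also have "\<dots> \<le> D"
    unfolding operator_norm_def
  proof (rule cSUP_least)
    fix x assume "x \<in> {x \<in> X. NX x \<le> 1}"
    then obtain z where "z \<in> F" "NY (T x - z) \<le> D" using approx by blast
    then show "quotient_norm NY F (T x) \<le> D"
      unfolding quotient_norm_def by (intro cINF_lower2[OF bdd])
  qed (use x0 in auto)
  finally show ?thesis .
qed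

section \<open>The weakly singular operator\<close>

context singular_kernel
begin

definition row :: "real \<Rightarrow> real \<Rightarrow> real" where "row t x = ker \<bar>t - x\<bar>"

lemma row_measurable [measurable]: "row t \<in> borel_measurable borel"
  unfolding row_def[abs_def] by measurable

lemma row_square: "(row t x)\<^sup>2 = even_ker_square (t + (-1) * x)"
  by (simp add: row_def even_ker_square_def)

lemma row_square_integrable: "integrable unit_lborel (\<lambda>x. (row t x)\<^sup>2)"
  unfolding row_square by (intro integrable_unit lborel_integrable_real_affine even_ker_square_integrable) simp

lemma row_norm: "(LINT x|unit_lborel. (row t x)\<^sup>2) \<le> 2 * energy 1"
proof -
  have "(LINT x|unit_lborel. (row t x)\<^sup>2) \<le> (LINT x|lborel. even_ker_square (t + (-1) * x))"
    unfolding row_square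
    by (intro integral_unit_le lborel_integrable_real_affine even_ker_square_integrable) (auto simp: even_ker_square_def)
  also have "\<dots> = (LINT x|lborel. even_ker_square x)"
    using lborel_integral_real_affine[of "-1" even_ker_square t] by simp
  also have "\<dots> = (LINT x|lborel. indicator {-1..1} x * even_ker_square x)"
    by (intro Bochner_Integration.integral_cong) (auto simp: even_ker_square_def ker_def indicator_def)
  also have "\<dots> = 2 * energy 1" using even_ker_square_interval[of 1] by simp
  finally show ?thesis .
qed

text \<open>With \<open>c\<close> the midpoint of \<open>s\<close> and \<open>t\<close>, the inequality \<open>(a - b)\<^sup>2 \<le> \<bar>a\<^sup>2 - b\<^sup>2\<bar>\<close> bounds the integrand by a difference
of two translates of the squared kernel, in opposite directions.\<close>

lemma row_diff_norm:
  assumes "\<bar>t - s\<bar> \<le> h"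
  shows "(LINT x|unit_lborel. (row t x - row s x)\<^sup>2) \<le> 4 * energy h"
proof -
  define d where "d = \<bar>t - s\<bar> / 2"
  have d: "0 \<le> d" "d \<le> h" using assms by (auto simp: d_def)
  define c where "c = (t + s) / 2"
  have "(row t x - row s x)\<^sup>2 \<le> \<bar>even_ker_square (c + (-1) * x + d) - even_ker_square (c + (-1) * x - d)\<bar>" for x
  proof -
    have "(a - b)\<^sup>2 \<le> \<bar>a\<^sup>2 - b\<^sup>2\<bar>" if "0 \<le> a" "0 \<le> b" for a b :: real
    proof -
      have "(a - b)\<^sup>2 = \<bar>a - b\<bar> * \<bar>a - b\<bar>" by (simp add: power2_eq_square)
      also have "\<dots> \<le> \<bar>a - b\<bar> * (a + b)" using that by (intro mult_left_mono) auto
      also have "\<dots> = \<bar>a\<^sup>2 - b\<^sup>2\<bar>" using that by (simp add: abs_mult power2_eq_square square_diff_square_factored)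
      finally show ?thesis .
    qed
    then have "(row t x - row s x)\<^sup>2 \<le> \<bar>even_ker_square (t - x) - even_ker_square (s - x)\<bar>"
      using ker_nonneg by (simp add: row_def even_ker_square_def)
    moreover have "(t = c + d \<and> s = c - d) \<or> (t = c - d \<and> s = c + d)"
      by (auto simp: c_def d_def abs_if field_simps)
    ultimately show ?thesis by (auto simp: algebra_simps abs_minus_commute)
  qed
  moreover have int: "integrable lborel (\<lambda>x. \<bar>even_ker_square (c + (-1) * x + d) - even_ker_square (c + (-1) * x - d)\<bar>)"
    using lborel_integrable_real_affine[OF even_ker_square_shift(2)[OF d(1)], of "-1" c] by simp
  ultimately have "(LINT x|unit_lborel. (row t x - row s x)\<^sup>2)
     \<le> (LINT x|unit_lborel. \<bar>even_ker_square (c + (-1) * x + d) - even_ker_square (c + (-1) * x - d)\<bar>)"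
    by (intro integral_mono integrable_unit integrable_diff_square row_square_integrable measurable_unit row_measurable)
  also have "\<dots> \<le> (LINT x|lborel. \<bar>even_ker_square (c + (-1) * x + d) - even_ker_square (c + (-1) * x - d)\<bar>)"
    using int by (intro integral_unit_le) auto
  also have "\<dots> = (LINT x|lborel. \<bar>even_ker_square (x + d) - even_ker_square (x - d)\<bar>)"
    using lborel_integral_real_affine[of "-1" "\<lambda>x. \<bar>even_ker_square (x + d) - even_ker_square (x - d)\<bar>" c] by simp
  also have "\<dots> \<le> 4 * energy d" by (rule even_ker_square_shift(1)[OF d(1)])
  also have "\<dots> \<le> 4 * energy h" using energy_mono[OF d(2)] by simp
  finally show ?thesis .
qed

definition op_fun :: "(real \<Rightarrow> real) \<Rightarrow> real \<Rightarrow> real" where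
  "op_fun f t = (LINT x|unit_lborel. row t x * f x)"

text \<open>Passing from \<open>k\<close> to its extension changes the integrand only at \<open>x = t\<close>, where \<open>k 0\<close> is arbitrary.\<close>

lemma weak_sing_op_eq_op_fun:
  assumes f: "f \<in> borel_measurable unit_lborel"
  shows "weak_sing_op k (abs_ae_fun f) = abs_ae_fun (op_fun f)"
proof -
  have eq: "k \<bar>t - x\<bar> = (if x = t then k 0 else row t x)" if "t \<in> {0..1}" "x \<in> {0..1}" for t x
    using that by (auto simp: row_def ker_def)
  have meas: "(\<lambda>x. if x = t then k 0 else row t x) \<in> borel_measurable unit_lborel" for t
    by (rule measurable_unit) measurable
  have "weak_sing_op k (abs_ae_fun f) = abs_ae_fun (\<lambda>t. LINT x|unit_lborel. k \<bar>t - x\<bar> * f x)"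
  proof (rule weak_sing_op_abs[OF f])
    fix t :: real assume "t \<in> {0..1}"
    then show "(\<lambda>x. k \<bar>t - x\<bar>) \<in> borel_measurable unit_lborel"
      using meas[of t] eq by (subst measurable_cong[where g = "\<lambda>x. if x = t then k 0 else row t x"]) auto
  qed
  also have "\<dots> = abs_ae_fun (op_fun f)"
  proof (rule abs_ae_fun_cong)
    fix t :: real assume t: "t \<in> {0..1}"
    have "(LINT x|unit_lborel. k \<bar>t - x\<bar> * f x) = (LINT x|unit_lborel. (if x = t then k 0 else row t x) * f x)"
      using eq[OF t] by (intro Bochner_Integration.integral_cong) auto
    also have "\<dots> = op_fun f t"
      unfolding op_fun_def
    proof (rule integral_cong_AE)
      show "AE x in unit_lborel. (if x = t then k 0 else row t x) * f x = row t x * f x"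
        by (intro AE_unit eventually_mono[OF AE_lborel_singleton[of t]]) simp
      show "(\<lambda>x. (if x = t then k 0 else row t x) * f x) \<in> borel_measurable unit_lborel"
        by (intro borel_measurable_times meas f)
      show "(\<lambda>x. row t x * f x) \<in> borel_measurable unit_lborel"
        by (intro borel_measurable_times measurable_unit row_measurable f)
    qed
    finally show "(LINT x|unit_lborel. k \<bar>t - x\<bar> * f x) = op_fun f t" .
  qed
  finally show ?thesis .
qed

lemma op_fun_measurable:
  assumes f: "f \<in> borel_measurable unit_lborel"
  shows "op_fun f \<in> borel_measurable unit_lborel"
proof -
  have g [measurable]: "(\<lambda>x. indicator {0..1} x * f x) \<in> borel_measurable borel"
    using f by (simp add: borel_measurable_restrict_space_iff mult.commute)
  have "(\<lambda>t. LINT x|lborel. ker \<bar>t - x\<bar> * (indicator {0..1} x * f x)) \<in> borel_measurable borel"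
    by measurable
  moreover have "(\<lambda>t. LINT x|lborel. ker \<bar>t - x\<bar> * (indicator {0..1} x * f x)) = op_fun f"
    by (simp add: op_fun_def integral_unit row_def fun_eq_iff mult_ac)
  ultimately show ?thesis by (simp add: measurable_unit)
qed

context
  fixes f :: "real \<Rightarrow> real"
  assumes f: "f \<in> borel_measurable unit_lborel" and f2: "integrable unit_lborel (\<lambda>x. (f x)\<^sup>2)"
begin

lemma row_mult_integrable: "integrable unit_lborel (\<lambda>x. row t x * f x)"
  by (intro integrable_mult_of_squares measurable_unit row_measurable f row_square_integrable f2)

lemma op_fun_bound: "\<bar>op_fun f t\<bar> \<le> sqrt (2 * energy 1) * sqrt (LINT x|unit_lborel. (f x)\<^sup>2)"
proof -
  have "(op_fun f t)\<^sup>2 \<le> (LINT x|unit_lborel. (row t x)\<^sup>2) * (LINT x|unit_lborel. (f x)\<^sup>2)"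
    unfolding op_fun_def
    by (intro Cauchy_Schwarz_integral measurable_unit row_measurable f row_square_integrable f2)
  also have "\<dots> \<le> 2 * energy 1 * (LINT x|unit_lborel. (f x)\<^sup>2)"
    by (intro mult_right_mono row_norm) simp
  finally have "sqrt ((op_fun f t)\<^sup>2) \<le> sqrt (2 * energy 1 * (LINT x|unit_lborel. (f x)\<^sup>2))"
    by (rule real_sqrt_le_mono)
  then show ?thesis by (simp add: real_sqrt_mult)
qed

lemma op_fun_diff: "op_fun f t - op_fun f s = (LINT x|unit_lborel. (row t x - row s x) * f x)"
  unfolding op_fun_def by (simp add: row_mult_integrable left_diff_distrib)

lemma op_fun_diff_bound:
  assumes "(LINT x|unit_lborel. (f x)\<^sup>2) \<le> 1" "\<bar>t - s\<bar> \<le> h"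
  shows "\<bar>op_fun f t - op_fun f s\<bar> \<le> 2 * sqrt (energy h)"
proof -
  have "(op_fun f t - op_fun f s)\<^sup>2 \<le> (LINT x|unit_lborel. (row t x - row s x)\<^sup>2) * (LINT x|unit_lborel. (f x)\<^sup>2)"
    unfolding op_fun_diff
    by (intro Cauchy_Schwarz_integral borel_measurable_diff integrable_diff_square measurable_unit
        row_measurable f row_square_integrable f2)
  also have "\<dots> \<le> 4 * energy h * 1"
    using assms row_diff_norm[of t s h] energy_nonneg by (intro mult_mono) auto
  finally have "sqrt ((op_fun f t - op_fun f s)\<^sup>2) \<le> sqrt (4 * energy h)"
    by (intro real_sqrt_le_mono) simp
  then show ?thesis by (simp add: real_sqrt_mult)
qed

end

lemma op_bounded:
  assumes q: "1 \<le> q" and x: "x \<in> Lp 2"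
  shows "weak_sing_op k x \<in> Lp q" "Lp_norm q (weak_sing_op k x) \<le> sqrt (2 * energy 1) * Lp_norm 2 x"
proof -
  obtain f where f: "f \<in> borel_measurable unit_lborel" "x = abs_ae_fun f" by (rule ae_fun_cases)
  have f2: "integrable unit_lborel (\<lambda>x. (f x)\<^sup>2)" using x f by (simp add: abs_in_L2)
  note bd = Lp_bounded[OF op_fun_measurable[OF f(1)] op_fun_bound[OF f(1) f2] q]
  show "weak_sing_op k x \<in> Lp q" "Lp_norm q (weak_sing_op k x) \<le> sqrt (2 * energy 1) * Lp_norm 2 x"
    unfolding f(2) weak_sing_op_eq_op_fun[OF f(1)] abs_L2_norm[OF f(1)] by (rule bd)+
qed

lemma op_bounded_operator:
  assumes q: "1 \<le> q"
  shows "bounded_operator (Lp 2) (Lp_norm 2) (Lp q) (Lp_norm q) (weak_sing_op k)"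
  unfolding bounded_operator_def
proof (intro conjI ballI allI)
  show "weak_sing_op k x \<in> Lp q" if "x \<in> Lp 2" for x using op_bounded(1)[OF q that] .
  show "\<exists>C. \<forall>x\<in>Lp 2. Lp_norm q (weak_sing_op k x) \<le> C * Lp_norm 2 x"
    using op_bounded(2)[OF q] by blast
next
  fix x y assume xy: "x \<in> Lp 2" "y \<in> Lp 2"
  obtain f where f: "f \<in> borel_measurable unit_lborel" "x = abs_ae_fun f" by (rule ae_fun_cases)
  obtain g where g: "g \<in> borel_measurable unit_lborel" "y = abs_ae_fun g" by (rule ae_fun_cases)
  have sq: "integrable unit_lborel (\<lambda>x. (f x)\<^sup>2)" "integrable unit_lborel (\<lambda>x. (g x)\<^sup>2)"
    using xy f g by (auto simp: abs_in_L2)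
  have "op_fun (\<lambda>x. f x + g x) = (\<lambda>t. op_fun f t + op_fun g t)"
    using row_mult_integrable[OF f(1) sq(1)] row_mult_integrable[OF g(1) sq(2)]
    by (simp add: op_fun_def fun_eq_iff distrib_left)
  then show "weak_sing_op k (x + y) = weak_sing_op k x + weak_sing_op k y"
    using f g by (simp add: abs_plus weak_sing_op_eq_op_fun op_fun_measurable)
next
  fix a :: real and x assume "x \<in> Lp 2"
  obtain f where f: "f \<in> borel_measurable unit_lborel" "x = abs_ae_fun f" by (rule ae_fun_cases)
  have "op_fun (\<lambda>x. a * f x) = (\<lambda>t. a * op_fun f t)"
    by (simp add: op_fun_def fun_eq_iff mult.left_commute)
  then show "weak_sing_op k (a *\<^sub>R x) = a *\<^sub>R weak_sing_op k x"
    using f by (simp add: abs_scale[OF f(1)] abs_scale[OF op_fun_measurable] weak_sing_op_eq_op_fun)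
qed

text \<open>The approximating space is spanned by step functions on a grid so fine that the operator changes by
at most \<open>\<delta>\<close> within a cell: the \<open>p\<close> indicators \<open>u\<close> of the groups of fine cells that share a
point of the coarse grid \<open>0, 1 / p, \<dots>\<close>, and the \<open>p\<close> random vectors \<open>v\<close> belonging to the differences \<open>w\<^sub>i\<close> of the
rows at the fine point \<open>i / N\<close> and at its coarse point.\<close>

lemma width_upper_bound:
  assumes p: "1 \<le> p" and m: "1 \<le> m" and q: "1 \<le> q" "q \<le> 2 * real m"
  shows "\<exists>B. finite B \<and> card B \<le> 2 * p \<and> span B \<subseteq> Lp q \<and>
    (\<forall>x\<in>Lp 2. Lp_norm 2 x \<le> 1 \<longrightarrow> (\<exists>z\<in>span B. Lp_norm q (weak_sing_op k x - z)
        \<le> 256 * sqrt (2 * real m / real p) * sqrt (energy (1 / real p))))"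
proof -
  define \<rho> where "\<rho> = 2 * sqrt (energy (1 / real p))"
  have \<rho>: "0 < \<rho>" "\<rho>\<^sup>2 = 4 * energy (1 / real p)"
    using p energy_pos[of "1 / real p"] by (auto simp: \<rho>_def power_mult_distrib)
  define \<delta> where "\<delta> = 16 * sqrt (2 * real m / real p) * \<rho>"
  have \<delta>: "0 < \<delta>" using \<rho> p m by (simp add: \<delta>_def)
  have "eventually (\<lambda>N. energy (1 / real (Suc N)) < (\<delta> / 2)\<^sup>2) sequentially"
    using energy_tendsto_0 \<delta> by (intro order_tendstoD(2)) auto
  then obtain N' where N': "energy (1 / real (Suc N')) < (\<delta> / 2)\<^sup>2"
    unfolding eventually_sequentially by blast
  define N where "N = Suc N'"
  have N: "1 \<le> N" by (simp add: N_def)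
  have fine: "2 * sqrt (energy (1 / real N)) \<le> \<delta>"
  proof -
    have "sqrt (energy (1 / real N)) \<le> sqrt ((\<delta> / 2)\<^sup>2)"
      using N' unfolding N_def by (intro real_sqrt_le_mono) simp
    then show ?thesis using \<delta> by simp
  qed
  \<comment> \<open>the index of the coarse point below \<open>i / N\<close>; the fine grid need not refine the coarse one\<close>
  define crs where "crs i = (i * p) div N" for i
  have crs_less: "crs i < p" if "i < N" for i
    using that N p unfolding crs_def by (simp add: div_less_iff_less_mult)
  have crs_near: "\<bar>real i / real N - real (crs i) / real p\<bar> \<le> 1 / real p" for i
  proof -
    have "crs i * N \<le> i * p" "i * p < (crs i + 1) * N"
      using N unfolding crs_def by (auto simp: dividend_less_div_times)
    then have "real (crs i * N) \<le> real (i * p)" "real (i * p) \<le> real ((crs i + 1) * N)"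
      by (simp_all only: of_nat_le_iff less_imp_le)
    then have le: "real (crs i * N) / (real p * real N) \<le> real (i * p) / (real p * real N)"
      "real (i * p) / (real p * real N) \<le> real ((crs i + 1) * N) / (real p * real N)"
      by (simp_all only: divide_right_mono mult_nonneg_nonneg of_nat_0_le_iff)
    have cancel: "a * real N / (real p * real N) = a / real p" "a * real p / (real p * real N) = a / real N" for a
      using N p by simp_all
    have "real (crs i) / real p \<le> real i / real N" "real i / real N \<le> real (crs i + 1) / real p"
      using le unfolding of_nat_mult cancel by auto
    moreover have "real (crs i + 1) / real p = real (crs i) / real p + 1 / real p"
      by (simp add: add_divide_distrib)
    ultimately show ?thesis by linarith
  qed
  define w where "w i x = row (real i / real N) x - row (real (crs i) / real p) x" for i x
  have w_meas: "w i \<in> borel_measurable unit_lborel" for i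
    unfolding w_def[abs_def] by (intro borel_measurable_diff measurable_unit row_measurable)
  have w_sq: "integrable unit_lborel (\<lambda>x. (w i x)\<^sup>2)" for i
    unfolding w_def by (intro integrable_diff_square measurable_unit row_measurable row_square_integrable)
  have w_mult: "integrable unit_lborel (\<lambda>x. w i x * w j x)" for i j
    by (intro integrable_mult_of_squares w_meas w_sq)
  define G where "G i j = (LINT x|unit_lborel. w i x * w j x)" for i j
  have sum_sq: "(\<Sum>i<N. \<phi> i * w i x)\<^sup>2 = (\<Sum>i<N. \<Sum>j<N. \<phi> i * \<phi> j * (w i x * w j x))" for \<phi> x
    unfolding power2_eq_square sum_product by (intro sum.cong refl) (simp only: mult_ac)
  have gram: "(\<Sum>i<N. \<Sum>j<N. \<phi> i * \<phi> j * G i j) = (LINT x|unit_lborel. (\<Sum>i<N. \<phi> i * w i x)\<^sup>2)"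
    "integrable unit_lborel (\<lambda>x. (\<Sum>i<N. \<phi> i * w i x)\<^sup>2)" for \<phi>
    unfolding sum_sq G_def by (simp_all add: w_mult)
  have sym: "G i j = G j i" for i j by (simp add: G_def mult.commute)
  have psd: "0 \<le> (\<Sum>i<N. \<Sum>j<N. \<phi> i * \<phi> j * G i j)" for \<phi> unfolding gram by simp
  have diag: "G i i \<le> \<rho>\<^sup>2" for i
    using row_diff_norm[OF crs_near[of i]] unfolding G_def w_def \<rho>(2) by (simp add: power2_eq_square)
  obtain v :: "nat \<Rightarrow> nat \<Rightarrow> real" where v: "\<And>y. (\<forall>\<phi>. (\<Sum>i<N. \<phi> i * y i)\<^sup>2 \<le> (\<Sum>i<N. \<Sum>j<N. \<phi> i * \<phi> j * G i j)) \<Longrightarrow>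
     (\<exists>a. (\<Sum>i<N. (y i - (\<Sum>j<p. a j * v j i)) ^ (2 * m)) \<le> real N * \<delta> ^ (2 * m))"
    using finite_kolmogorov_width[OF N m p \<rho>(1), of G] sym psd diag unfolding \<delta>_def by blast
  define u where "u c i = (if crs i = c then 1 else 0 :: real)" for c i
  define B where "B = (\<lambda>c. step_fun N (u c)) ` {..<p} \<union> (\<lambda>j. step_fun N (v j)) ` {..<p}"
  have B: "finite B" unfolding B_def by (intro finite_UnI finite_imageI finite_lessThan)
  have B_range: "B \<subseteq> range (step_fun N)" unfolding B_def by (intro Un_least image_subsetI rangeI)
  have card: "card B \<le> 2 * p"
  proof -
    have "card B \<le> card ((\<lambda>c. step_fun N (u c)) ` {..<p}) + card ((\<lambda>j. step_fun N (v j)) ` {..<p})"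
      unfolding B_def by (rule card_Un_le)
    also have "\<dots> \<le> card {..<p} + card {..<p}" by (intro add_mono card_image_le) auto
    finally show ?thesis by simp
  qed
  have "span B \<subseteq> range (step_fun N)" using B_range subspace_step_fun by (rule span_minimal)
  also have "range (step_fun N) \<subseteq> Lp q" by (rule image_subsetI) (rule step_fun_in_Lp[OF q(1)])
  finally have spanB: "span B \<subseteq> Lp q" .
  have approx: "\<exists>z\<in>span B. Lp_norm q (weak_sing_op k x - z) \<le> 8 * \<delta>"
    if x: "x \<in> Lp 2" "Lp_norm 2 x \<le> 1" for x
  proof -
    obtain f where f: "f \<in> borel_measurable unit_lborel" "x = abs_ae_fun f" by (rule ae_fun_cases)
    have f2: "integrable unit_lborel (\<lambda>x. (f x)\<^sup>2)" using x f by (simp add: abs_in_L2)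
    have norm_f: "(LINT x|unit_lborel. (f x)\<^sup>2) \<le> 1"
      using x(2) f by (simp add: abs_L2_norm)
    define y where "y i = (LINT x|unit_lborel. w i x * f x)" for i
    have wf: "integrable unit_lborel (\<lambda>x. w i x * f x)" for i
      by (intro integrable_mult_of_squares w_meas w_sq f f2)
    have y_eq: "y i = op_fun f (real i / real N) - op_fun f (real (crs i) / real p)" for i
      by (simp add: y_def w_def op_fun_diff[OF f(1) f2])
    have "(\<Sum>i<N. \<phi> i * y i)\<^sup>2 \<le> (\<Sum>i<N. \<Sum>j<N. \<phi> i * \<phi> j * G i j)" for \<phi>
    proof -
      have "(\<Sum>i<N. \<phi> i * y i) = (LINT x|unit_lborel. (\<Sum>i<N. \<phi> i * w i x) * f x)"
        unfolding y_def sum_distrib_right mult.assoc by (simp add: wf)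
      moreover have "(\<lambda>x. \<Sum>i<N. \<phi> i * w i x) \<in> borel_measurable unit_lborel"
        by (intro borel_measurable_sum borel_measurable_times borel_measurable_const w_meas)
      ultimately have "(\<Sum>i<N. \<phi> i * y i)\<^sup>2 \<le> (LINT x|unit_lborel. (\<Sum>i<N. \<phi> i * w i x)\<^sup>2) * (LINT x|unit_lborel. (f x)\<^sup>2)"
        by (simp only:) (intro Cauchy_Schwarz_integral gram(2) f f2)
      also have "\<dots> \<le> (LINT x|unit_lborel. (\<Sum>i<N. \<phi> i * w i x)\<^sup>2) * 1"
        by (intro mult_left_mono norm_f) simp
      finally show ?thesis by (simp add: gram)
    qed
    then obtain a where a: "(\<Sum>i<N. (y i - (\<Sum>j<p. a j * v j i)) ^ (2 * m)) \<le> real N * \<delta> ^ (2 * m)"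
      using v by blast
    define r where "r i = y i - (\<Sum>j<p. a j * v j i)" for i
    define b where "b c = op_fun f (real c / real p)" for c
    define z where "z = (\<Sum>c<p. b c *\<^sub>R step_fun N (u c)) + (\<Sum>j<p. a j *\<^sub>R step_fun N (v j))"
    have z: "z \<in> span B"
      unfolding z_def by (intro span_add span_sum span_scale span_base) (auto simp: B_def)
    define e where "e i = (\<Sum>c<p. b c * u c i) + (\<Sum>j<p. a j * v j i)" for i
    have z_eq: "z = abs_ae_fun (\<lambda>t. e (cell N t))"
      unfolding z_def step_fun_sum unfolding step_fun_def e_def
      by (rule abs_plus) (rule step_fun_meas)+
    have e_eq: "e i = b (crs i) + (\<Sum>j<p. a j * v j i)" if "i < N" for i
    proof -
      have "(\<Sum>c<p. b c * u c i) = (\<Sum>c<p. if c = crs i then b c else 0)"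
        by (intro sum.cong) (auto simp: u_def)
      then show ?thesis using crs_less[OF that] by (simp add: e_def)
    qed
    define h where "h t = op_fun f t - e (cell N t)" for t
    have h_meas: "h \<in> borel_measurable unit_lborel"
      unfolding h_def[abs_def] by (intro borel_measurable_diff op_fun_measurable f step_fun_meas)
    have h_eq: "weak_sing_op k x - z = abs_ae_fun h"
      unfolding f(2) weak_sing_op_eq_op_fun[OF f(1)] z_eq h_def
      by (rule abs_minus) (intro op_fun_measurable f step_fun_meas)+
    have h_le: "h t ^ (2 * m) \<le> 4 ^ m * (\<delta> ^ (2 * m) + r (cell N t) ^ (2 * m))" if t: "0 \<le> t" "t < 1" for t
    proof -
      let ?i = "cell N t"
      note cb = cell_bounds[OF t N]
      have "h t = (op_fun f t - op_fun f (real ?i / real N)) + r ?i"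
        unfolding h_def e_eq[OF cb(1)] r_def y_eq b_def by simp
      moreover have "\<bar>op_fun f t - op_fun f (real ?i / real N)\<bar> \<le> 2 * sqrt (energy (1 / real N))"
        using cb by (intro op_fun_diff_bound f f2 norm_f) auto
      ultimately have "\<bar>h t\<bar> \<le> \<delta> + \<bar>r ?i\<bar>" using fine by linarith
      also have "\<dots> \<le> 2 * max \<delta> \<bar>r ?i\<bar>" by simp
      finally have "\<bar>h t\<bar> ^ (2 * m) \<le> (2 * max \<delta> \<bar>r ?i\<bar>) ^ (2 * m)" by (intro power_mono) auto
      also have "\<dots> = 4 ^ m * max \<delta> \<bar>r ?i\<bar> ^ (2 * m)" by (simp add: power_mult_distrib power_mult)
      also have "max \<delta> \<bar>r ?i\<bar> ^ (2 * m) \<le> \<delta> ^ (2 * m) + \<bar>r ?i\<bar> ^ (2 * m)"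
        using \<delta> by (auto simp: max_def)
      finally show ?thesis by (simp add: power_even_abs)
    qed
    let ?g = "\<lambda>t. 4 ^ m * (\<delta> ^ (2 * m) + r (cell N t) ^ (2 * m))"
    have g_int: "integrable unit_lborel ?g"
      using integral_step(2)[OF N, of "\<lambda>i. r i ^ (2 * m)"] by auto
    have ae: "AE t in unit_lborel. h t ^ (2 * m) \<le> ?g t"
      using AE_lborel_singleton[of "1::real"] by (intro AE_unit) (auto elim!: eventually_mono intro!: h_le)
    have h_int: "integrable unit_lborel (\<lambda>t. h t ^ (2 * m))"
    proof (rule Bochner_Integration.integrable_bound[OF g_int])
      show "AE t in unit_lborel. norm (h t ^ (2 * m)) \<le> norm (?g t)"
        using ae by eventually_elim (simp add: power_even_abs)
    qed (use h_meas in auto)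
    have "(LINT t|unit_lborel. h t ^ (2 * m)) \<le> (LINT t|unit_lborel. ?g t)"
      by (intro integral_mono_AE h_int g_int ae)
    also have "\<dots> = 4 ^ m * (\<delta> ^ (2 * m) + (\<Sum>i<N. r i ^ (2 * m)) / real N)"
      using integral_step[OF N, of "\<lambda>i. r i ^ (2 * m)"] by simp
    also have "\<dots> \<le> 4 ^ m * (\<delta> ^ (2 * m) + \<delta> ^ (2 * m))"
      using a N by (intro mult_left_mono add_left_mono) (auto simp: r_def field_simps)
    also have "\<dots> = 2 * (2 * \<delta>) ^ (2 * m)"
      unfolding power_mult_distrib power_mult[of 2] by simp
    also have "\<dots> \<le> 2 ^ (2 * m) * (2 * \<delta>) ^ (2 * m)"
      using m by (intro mult_right_mono self_le_power) auto
    also have "\<dots> = (4 * \<delta>) ^ (2 * m)" unfolding power_mult_distrib[symmetric] by simp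
    finally have "Lp_norm q (abs_ae_fun h) \<le> 2 * (4 * \<delta>)"
      using \<delta> by (intro Lp_norm_le_even_moment[OF h_meas h_int _ _ q]) auto
    then show ?thesis using z h_eq by (intro bexI[of _ z]) auto
  qed
  have eq: "8 * \<delta> = 256 * sqrt (2 * real m / real p) * sqrt (energy (1 / real p))"
    by (simp add: \<delta>_def \<rho>_def)
  show ?thesis
    using approx unfolding eq
    by (intro exI[of _ B] conjI ballI impI B card spanB)
qed

lemma energy_multiple: "0 \<le> a \<Longrightarrow> energy (real j * a) \<le> real j * energy a"
proof (induction j)
  case 0
  then show ?case by (simp add: energy_def)
next
  case (Suc j)
  have "energy (real (Suc j) * a) = energy (real j * a + a)" by (simp add: algebra_simps)
  also have "\<dots> \<le> energy (real j * a) + energy a" using Suc.prems by (intro energy_add_le) auto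
  also have "\<dots> \<le> real (Suc j) * energy a" using Suc by (simp add: algebra_simps)
  finally show ?case .
qed

text \<open>For \<open>n \<ge> 3\<close> take \<open>p\<close> with \<open>2 p < n \<le> 4 p\<close> and the least even integer \<open>2 m \<ge> q\<close>; both changes cost
constants by \<open>energy_multiple\<close> and \<open>2 m \<le> 3 q\<close>. For \<open>n \<le> 2\<close> the operator norm is already small
enough.\<close>

lemma kolmogorov_bound:
  assumes q: "1 \<le> q" and n: "1 \<le> n"
  shows "sqrt (real n) * kolmogorov_number (Lp 2) (Lp_norm 2) (Lp q) (Lp_norm q) n (weak_sing_op k)
    \<le> 2048 * sqrt q * sqrt (energy (1 / real n))"
proof -
  let ?d = "kolmogorov_number (Lp 2) (Lp_norm 2) (Lp q) (Lp_norm q) n (weak_sing_op k)"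
  let ?E = "energy (1 / real n)"
  have zero: "0 \<in> Lp 2" "Lp_norm 2 0 \<le> 1"
    by (simp_all add: zero_ae_fun_abs abs_in_L2 abs_L2_norm)
  have norm: "Lp_norm q (weak_sing_op k x) \<le> sqrt (2 * energy 1)" if "x \<in> Lp 2" "Lp_norm 2 x \<le> 1" for x
  proof -
    have "sqrt (2 * energy 1) * Lp_norm 2 x \<le> sqrt (2 * energy 1) * 1"
      using that energy_nonneg[of 1] by (intro mult_left_mono) auto
    then show ?thesis using op_bounded(2)[OF q that(1)] by simp
  qed
  note le = kolmogorov_number_le[where NY = "Lp_norm q" and T = "weak_sing_op k" and X = "Lp 2"
      and NX = "Lp_norm 2" and Y = "Lp q", OF Lp_norm_nonneg zero norm]
  show ?thesis
  proof (cases "n \<le> 2")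
    case True
    have "?d \<le> sqrt (2 * energy 1)"
    proof (rule le[where F = "{0}" and B = "{}"])
      show "{0} \<subseteq> Lp q" using step_fun_in_Lp[OF q, of 1 "\<lambda>_. 0"] by (simp add: step_fun_def zero_ae_fun_abs)
      have "dim {0 :: ae_fun} \<le> card ({} :: ae_fun set)" by (rule dim_le_card) auto
      then show "dim {0 :: ae_fun} < n" using n by simp
    qed (use norm in \<open>auto simp: subspace_single_0\<close>)
    also have "\<dots> \<le> sqrt (4 * ?E)"
    proof (rule real_sqrt_le_mono)
      have "energy 1 \<le> real n * ?E" using energy_multiple[of "1 / real n" n] n by simp
      also have "\<dots> \<le> 2 * ?E" using True energy_nonneg by (intro mult_right_mono) auto
      finally show "2 * energy 1 \<le> 4 * ?E" by simp
    qed
    finally have "sqrt (real n) * ?d \<le> sqrt (real n) * (2 * sqrt ?E)"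
      by (intro mult_left_mono) (auto simp: real_sqrt_mult)
    also have "\<dots> \<le> 2 * (2 * sqrt ?E)"
    proof (intro mult_right_mono)
      have "sqrt (real n) \<le> sqrt (2\<^sup>2)" unfolding real_sqrt_le_iff using True by simp
      then show "sqrt (real n) \<le> 2" by simp
    qed (simp add: energy_nonneg)
    also have "\<dots> \<le> (2048 * sqrt q) * sqrt ?E"
    proof -
      have "1 \<le> sqrt q" using q by simp
      then have "4 \<le> 2048 * sqrt q" by linarith
      from mult_right_mono[OF this, of "sqrt ?E"] show ?thesis by (simp add: energy_nonneg)
    qed
    finally show ?thesis .
  next
    case False
    define p where "p = (n - 1) div 2"
    have "n = 2 * p + 1 \<or> n = 2 * p + 2" using n unfolding p_def by presburger
    then have p: "1 \<le> p" "2 * p < n" "n \<le> 4 * p" using False by auto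
    define m where "m = nat \<lceil>q / 2\<rceil>"
    have m: "1 \<le> m" "q \<le> 2 * real m" "2 * real m \<le> 3 * q"
    proof -
      have "real m = of_int \<lceil>q / 2\<rceil>" using q by (simp add: m_def)
      then show "q \<le> 2 * real m" "2 * real m \<le> 3 * q" using q by linarith+
      then show "1 \<le> m" using q by linarith
    qed
    obtain B where B: "finite B" "card B \<le> 2 * p" "span B \<subseteq> Lp q"
      "\<And>x. x \<in> Lp 2 \<Longrightarrow> Lp_norm 2 x \<le> 1 \<Longrightarrow> \<exists>z\<in>span B. Lp_norm q (weak_sing_op k x - z)
        \<le> 256 * sqrt (2 * real m / real p) * sqrt (energy (1 / real p))"
      using width_upper_bound[OF p(1) m(1) q m(2)] by blast
    have "?d \<le> 256 * sqrt (2 * real m / real p) * sqrt (energy (1 / real p))"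
    proof (rule le[where F = "span B" and B = B])
      have "dim (span B) \<le> card B" by (rule dim_le_card[OF order_refl B(1)])
      then show "dim (span B) < n" using B(2) p(2) by simp
    qed (use B in auto)
    also have "\<dots> \<le> 256 * sqrt (12 * q / real n) * sqrt (4 * ?E)"
    proof (intro mult_mono real_sqrt_le_mono)
      have "2 * real m / real p \<le> 3 * q / real p" using m p by (intro divide_right_mono) auto
      also have "\<dots> \<le> 12 * q / real n"
      proof -
        have "3 * q / real p = 12 * q / real (4 * p)" by simp
        also have "\<dots> \<le> 12 * q / real n"
          using p q n by (intro divide_left_mono) (simp_all del: of_nat_mult)
        finally show ?thesis .
      qed
      finally show "2 * real m / real p \<le> 12 * q / real n" .
      have "1 / real p = 4 / real (4 * p)" by simp
      also have "\<dots> \<le> 4 / real n"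
        using p n by (intro divide_left_mono) (simp_all del: of_nat_mult)
      finally have "1 / real p \<le> real 4 * (1 / real n)" by simp
      then have "energy (1 / real p) \<le> energy (real 4 * (1 / real n))" by (rule energy_mono)
      also have "\<dots> \<le> real 4 * ?E" by (rule energy_multiple) simp
      finally show "energy (1 / real p) \<le> 4 * ?E" by simp
    qed (use q energy_nonneg in auto)
    finally have "sqrt (real n) * ?d \<le> sqrt (real n) * (256 * sqrt (12 * q / real n) * sqrt (4 * ?E))"
      by (intro mult_left_mono) auto
    also have "\<dots> = 512 * sqrt 12 * sqrt q * sqrt ?E"
    proof -
      have "sqrt (12 * q / real n) = sqrt 12 * sqrt q / sqrt (real n)" "sqrt (4 * ?E) = 2 * sqrt ?E"
        by (simp_all add: real_sqrt_mult real_sqrt_divide)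
      then show ?thesis using n by simp
    qed
    also have "\<dots> \<le> 2048 * sqrt q * sqrt ?E"
    proof (intro mult_right_mono)
      have "sqrt 12 \<le> sqrt (4\<^sup>2)" unfolding real_sqrt_le_iff by simp
      then show "512 * sqrt 12 \<le> (2048::real)" by simp
    qed (use q energy_nonneg in auto)
    finally show ?thesis .
  qed
qed

end

theorem theorem5p17:
  "\<exists>c::real. c \<ge> 1 \<and>
    (\<forall>(k :: real \<Rightarrow> real) (q :: real).
       (\<forall>x\<in>{0<..1}. 0 \<le> k x) \<longrightarrow>
       continuous_on {0<..1} k \<longrightarrow>
       strict_antimono_on {0<..1} k \<longrightarrow>
       filterlim k at_top (at_right 0) \<longrightarrow>
       set_integrable lborel {0<..1} (\<lambda>u. (k u)\<^sup>2) \<longrightarrow>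
       1 \<le> q \<longrightarrow>
       bounded_operator (Lp 2) (Lp_norm 2) (Lp q) (Lp_norm q) (weak_sing_op k) \<and>
       (\<forall>n::nat. 1 \<le> n \<longrightarrow>
          sqrt (real n) *
            kolmogorov_number (Lp 2) (Lp_norm 2) (Lp q) (Lp_norm q) n (weak_sing_op k)
          \<le> c * sqrt q * sqrt (LINT u:{0<..1 / real n}|lborel. (k u)\<^sup>2)))"
proof (intro exI[of _ 2048] conjI allI impI)
  fix k :: "real \<Rightarrow> real" and q :: real
  assume "\<forall>x\<in>{0<..1}. 0 \<le> k x" "continuous_on {0<..1} k" "strict_antimono_on {0<..1} k"
    "filterlim k at_top (at_right 0)" "set_integrable lborel {0<..1} (\<lambda>u. (k u)\<^sup>2)" and q: "1 \<le> q"
  then interpret singular_kernel k by (intro singular_kernel.intro) blast+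
  show "bounded_operator (Lp 2) (Lp_norm 2) (Lp q) (Lp_norm q) (weak_sing_op k)"
    by (rule op_bounded_operator[OF q])
  fix n :: nat assume n: "1 \<le> n"
  then show "sqrt (real n) * kolmogorov_number (Lp 2) (Lp_norm 2) (Lp q) (Lp_norm q) n (weak_sing_op k)
     \<le> 2048 * sqrt q * sqrt (LINT u:{0<..1 / real n}|lborel. (k u)\<^sup>2)"
    using kolmogorov_bound[OF q n] by (simp add: energy_eq)
qed simp

end
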